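(* Let $g:\mathbb{R}^m\to\mathbb{R}^l$ be twice continuously differentiable, let $\Theta\subset\mathbb{R}^l$ be a closed convex cone, let $\Gamma:=g^{-1}(\Theta)$, let $f:\mathbb{R}^n\times\mathbb{R}^m\to\mathbb{R}^m$, and let $$S(x):=\{y\in\mathbb{R}^m\mid 0\in f(x,y)+\widehat N_\Gamma(y)\},\quad x\in\mathbb{R}^n.$$ Let $(\bar x,\bar y)\in\operatorname{gph}S$, suppose that $f$ is smooth (continuously differentiable) around $(\bar x,\bar y)$, that the standing assumptions (A1), (A2), (A3) given in the context hold at $\bar y$, and that $\Theta$ satisfies the projection derivation condition (PDC) at $g(\bar y)$. Let $\mathcal{L}(x,y,\lambda):=f(x,y)+(\nabla g(y))^T\lambda$ for $\lambda\in\mathbb{R}^l$, let $\bar\lambda\in N_\Theta(g(\bar y))$ be the unique Lagrange multiplier satisfying $\mathcal{L}(\bar x,\bar y,\bar\lambda)=0$, and let $\widehat{\mathcal K}:=\mathcal{K}(g(\bar y),\bar\lambda)=T_\Theta(g(\bar y))\cap\{\bar\lambda\}^\perp$. Assume that the adjoint generalized equation $$0\in\nabla_y\mathcal{L}(\bar x,\bar y,\bar\lambda)v+(\nabla g(\bar y))^TN_{\widehat{\mathcal K}}\big(\nabla g(\bar y)v\big)$$ in the unknown $v\in\mathbb{R}^m$ has only the trivial solution $v=0$. Then the solution map $S$ has the isolated calmness property at $(\bar x,\bar y)$. If in addition the partial Jacobian $\nabla_xf(\bar x,\bar y)$ is surjective, then the condition that the adjoint generalized equation $0\in\nabla_y\mathcal{L}(\bar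 x,\bar y,\bar\lambda)v+(\nabla g(\bar y))^TN_{\widehat{\mathcal K}}\big(\nabla g(\bar y)v\big)$ has only the trivial solution $v=0$ is also necessary for $S$ to have the isolated calmness property at $(\bar x,\bar y)$.
   Context: Notation: $\nabla g(y)$ is the Jacobian of $g$ at $y$; $\nabla_x,\nabla_y$ are partial Jacobians; $P_\Omega$ is the Euclidean metric projection onto a closed set $\Omega$; $f'(x;h)$ is the classical directional derivative; $\mathbb{B}$ is the closed unit ball. For convex sets $C$, $N_C(z)$ is the normal cone of convex analysis, with $N_C(z)=\emptyset$ for $z\notin C$. Isolated calmness: $F:\mathbb{R}^d\rightrightarrows\mathbb{R}^s$ has the isolated calmness property at $(\bar x,\bar y)\in\operatorname{gph}F$ if there exist neighborhoods $U$ of $\bar x$ and $V$ of $\bar y$ and a constant $\ell>0$ such that $F(x)\cap V\subset\{\bar y\}+\ell\|x-\bar x\|\mathbb{B}$ for all $x\in U$. Tangent cone: $T_\Omega(\bar z):=\{z\mid\exists\,t_k\downarrow0,\ z_k\to z\text{ with }\bar z+t_kz_k\in\Omega\}$. Regular normal cone: $\widehat N_\Omega(y):=\{v\mid\limsup_{u\to y,\,u\in\Omega}\langle v,u-y\rangle/\|u-y\|\le0\}$ for $y\in\Omega$, and $\widehat N_\Omega(y)=\emptyset$ for $y\notin\Omega$. Critical cone: $\mathcal{K}(\bar z,b):=T_\Theta(\bar z)\cap\{b\}^\perp$. Projection derivation condition (PDC) of $\Theta$ at $\bar z\in\Theta$: $P'_\Theta(\bar z+b;h)=P_{\mathcal{K}(\bar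 z,b)}(h)$ for all $b\in N_\Theta(\bar z)$ and all $h\in\mathbb{R}^l$. Standing assumptions, with $\bar z:=g(\bar y)$: (A1) $\Theta$ is $\mathcal{C}^2$-reducible at $\bar z$ to a closed convex set $\Xi\subset\mathbb{R}^q$, and the reduction is pointed: there exist a neighborhood $V$ of $\bar z$ and a $\mathcal{C}^2$-smooth mapping $\eta:V\to\mathbb{R}^q$ such that for all $z\in V$ one has $z\in\Theta$ if and only if $\eta(z)\in\Xi$, the cone $T_\Xi(\eta(\bar z))$ is pointed, $\eta(\bar z)=0$, and $\nabla\eta(\bar z):\mathbb{R}^l\to\mathbb{R}^q$ is surjective. (A2) $\bar y$ is nondegenerate for $g$ with respect to $\Theta$: $\nabla g(\bar y)\mathbb{R}^m+\operatorname{lin}(T_\Theta(\bar z))=\mathbb{R}^l$, where $\operatorname{lin}(Q)$ denotes the largest linear subspace contained in $Q$. (A3) The metric projection $P_\Theta$ is directionally differentiable on $\mathbb{R}^l$. *)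

theory Defs
  imports "HOL-Analysis.Analysis"
begin

section \<open>Smoothness and directional derivatives\<close>

text \<open>Both predicates are meant for open \<open>U\<close>.\<close>

definition C1_on :: "'a::real_normed_vector set \<Rightarrow> ('a \<Rightarrow> 'b::real_normed_vector) \<Rightarrow> bool"
  where "C1_on U f \<longleftrightarrow>
    (\<exists>f' :: 'a \<Rightarrow> 'a \<Rightarrow>\<^sub>L 'b.
      (\<forall>x\<in>U. (f has_derivative blinfun_apply (f' x)) (at x)) \<and> continuous_on U f')"

definition C2_on :: "'a::real_normed_vector set \<Rightarrow> ('a \<Rightarrow> 'b::real_normed_vector) \<Rightarrow> bool"
  where "C2_on U f \<longleftrightarrow>
    (\<exists>f' :: 'a \<Rightarrow> 'a \<Rightarrow>\<^sub>L 'b.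
      (\<forall>x\<in>U. (f has_derivative blinfun_apply (f' x)) (at x)) \<and> C1_on U f')"

definition has_dir_derivative ::
    "('a::real_normed_vector \<Rightarrow> 'b::real_normed_vector) \<Rightarrow> 'a \<Rightarrow> 'a \<Rightarrow> 'b \<Rightarrow> bool"
  where "has_dir_derivative f x h d \<longleftrightarrow>
    ((\<lambda>t. (f (x + t *\<^sub>R h) - f x) /\<^sub>R t) \<longlongrightarrow> d) (at_right 0)"

definition dir_differentiable ::
    "('a::real_normed_vector \<Rightarrow> 'b::real_normed_vector) \<Rightarrow> bool"
  where "dir_differentiable f \<longleftrightarrow> (\<forall>x h. \<exists>d. has_dir_derivative f x h d)"

section \<open>Cones\<close>

definition tangent_cone :: "'a::real_normed_vector set \<Rightarrow> 'a \<Rightarrow> 'a set"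
  where "tangent_cone \<Omega> z = {w. \<exists>t u. (\<forall>k::nat. 0 < t k) \<and> t \<longlonglongrightarrow> 0 \<and> u \<longlonglongrightarrow> w \<and>
    (\<forall>k. z + t k *\<^sub>R u k \<in> \<Omega>)}"

definition regular_normal_cone :: "'a::real_inner set \<Rightarrow> 'a \<Rightarrow> 'a set"
  where "regular_normal_cone \<Omega> y = (if y \<in> \<Omega>
    then {v. Limsup (at y within \<Omega>) (\<lambda>u. ereal (v \<bullet> (u - y) / norm (u - y))) \<le> 0}
    else {})"

definition normal_cone :: "'a::real_inner set \<Rightarrow> 'a \<Rightarrow> 'a set"
  where "normal_cone C z = (if z \<in> C then {v. \<forall>u\<in>C. v \<bullet> (u - z) \<le> 0} else {})"

definition critical_cone :: "'a::real_inner set \<Rightarrow> 'a \<Rightarrow> 'a \<Rightarrow> 'a set"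
  where "critical_cone \<Theta> z b = tangent_cone \<Theta> z \<inter> {w. b \<bullet> w = 0}"

definition pointed :: "'a::real_vector set \<Rightarrow> bool"
  where "pointed K \<longleftrightarrow> K \<inter> uminus ` K = {0}"

definition lin :: "'a::real_vector set \<Rightarrow> 'a set"
  where "lin Q = (GREATEST L. subspace L \<and> L \<subseteq> Q)"

section \<open>Conditions on the constraint system\<close>

text \<open>The directional derivative of the projection is required to exist, not merely to agree
  with the right-hand side where it does.\<close>

definition projection_derivation_condition :: "'a::euclidean_space set \<Rightarrow> 'a \<Rightarrow> bool"
  where "projection_derivation_condition \<Theta> z \<longleftrightarrow>
    (\<forall>b\<in>normal_cone \<Theta> z. \<forall>h.
      has_dir_derivative (closest_point \<Theta>) (z + b) h (closest_point (critical_cone \<Theta> z b) h))"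

definition pointed_reduction ::
    "(real^'l) set \<Rightarrow> real^'l \<Rightarrow> (real^'q) set \<Rightarrow> (real^'l) set \<Rightarrow> (real^'l \<Rightarrow> real^'q) \<Rightarrow> bool"
  where "pointed_reduction \<Theta> z \<Xi> V \<eta> \<longleftrightarrow>
    open V \<and> z \<in> V \<and> C2_on V \<eta> \<and> (\<forall>u\<in>V. u \<in> \<Theta> \<longleftrightarrow> \<eta> u \<in> \<Xi>) \<and>
    pointed (tangent_cone \<Xi> (\<eta> z)) \<and> \<eta> z = 0 \<and> surj (\<lambda>h. jacobian \<eta> (at z) *v h)"

text \<open>The second disjunct is the case \<open>q = 0\<close>, which the type \<open>real^'q\<close> does not cover:
  for \<open>\<Xi>\<close> a subset of \<open>\<real>\<^sup>0 = {0}\<close> and \<open>z \<in> \<Theta>\<close>, a pointed reduction exists precisely when some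
  neighbourhood of \<open>z\<close> is contained in \<open>\<Theta>\<close>. For \<open>q \<ge> 1\<close> an interior point of \<open>\<Theta>\<close> never has
  a pointed reduction, since then \<open>0\<close> is interior to \<open>\<Xi>\<close>.\<close>

definition pointed_C2_reducible :: "(real^'l) set \<Rightarrow> real^'l \<Rightarrow> (real^'q) set \<Rightarrow> bool"
  where "pointed_C2_reducible \<Theta> z \<Xi> \<longleftrightarrow>
    (closed \<Xi> \<and> convex \<Xi> \<and> (\<exists>V \<eta>. pointed_reduction \<Theta> z \<Xi> V \<eta>)) \<or> z \<in> interior \<Theta>"

definition nondegenerate :: "(real^'m \<Rightarrow> real^'l) \<Rightarrow> (real^'l) set \<Rightarrow> real^'m \<Rightarrow> bool"
  where "nondegenerate g \<Theta> y \<longleftrightarrow>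
    {jacobian g (at y) *v u + w | u w. w \<in> lin (tangent_cone \<Theta> (g y))} = UNIV"

section \<open>The generalized equation\<close>

definition solution_map ::
    "('x \<Rightarrow> real^'m \<Rightarrow> real^'m) \<Rightarrow> (real^'m) set \<Rightarrow> 'x \<Rightarrow> (real^'m) set"
  where "solution_map f \<Gamma> x = {y. 0 \<in> (\<lambda>v. f x y + v) ` regular_normal_cone \<Gamma> y}"

definition lagrangian ::
    "('x \<Rightarrow> real^'m \<Rightarrow> real^'m) \<Rightarrow> (real^'m \<Rightarrow> real^'l) \<Rightarrow> 'x \<Rightarrow> real^'m \<Rightarrow> real^'l \<Rightarrow> real^'m"
  where "lagrangian f g x y lam = f x y + transpose (jacobian g (at y)) *v lam"

definition lagrange_multipliers ::
    "('x \<Rightarrow> real^'m \<Rightarrow> real^'m) \<Rightarrow> (real^'m \<Rightarrow> real^'l) \<Rightarrow> (real^'l) set \<Rightarrow> 'x \<Rightarrow> real^'m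
      \<Rightarrow> (real^'l) set"
  where "lagrange_multipliers f g \<Theta> x y =
    {lam \<in> normal_cone \<Theta> (g y). lagrangian f g x y lam = 0}"

definition adjoint_solutions ::
    "('x \<Rightarrow> real^'m \<Rightarrow> real^'m) \<Rightarrow> (real^'m \<Rightarrow> real^'l) \<Rightarrow> (real^'l) set \<Rightarrow> 'x \<Rightarrow> real^'m
      \<Rightarrow> real^'l \<Rightarrow> (real^'m) set"
  where "adjoint_solutions f g \<Theta> x y lam =
    {v. 0 \<in> (\<lambda>w. jacobian (\<lambda>u. lagrangian f g x u lam) (at y) *v v
               + transpose (jacobian g (at y)) *v w)
          ` normal_cone (critical_cone \<Theta> (g y) lam) (jacobian g (at y) *v v)}"

definition isolated_calmness ::
    "('a::real_normed_vector \<Rightarrow> 'b::real_normed_vector set) \<Rightarrow> 'a \<Rightarrow> 'b \<Rightarrow> bool"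
  where "isolated_calmness F x y \<longleftrightarrow> y \<in> F x \<and>
    (\<exists>U V c. open U \<and> x \<in> U \<and> open V \<and> y \<in> V \<and> c > 0 \<and>
      (\<forall>x'\<in>U. F x' \<inter> V \<subseteq> cball y (c * norm (x' - x))))"

end

theory Submission
  imports Defs
begin

text \<open>Write \<open>A\<close> for the derivative of \<open>g\<close> at \<open>ybar\<close>. Solutions \<open>y\<close> near \<open>ybar\<close> are studied together
  with multipliers \<open>l \<in> normal_cone \<Theta> (g y)\<close> that solve \<open>\<Phi> (x, y, l) = f x y + (\<nabla>g y)\<^sup>T l = 0\<close>.

  Multipliers exist because normals to \<open>\<Theta>\<close> annihilate the lineality space \<open>L\<close> of the tangent cone,
  whereas by nondegeneracy no nonzero vector annihilates both \<open>L\<close> and the range of \<open>A\<close>. So no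
  nonzero normal is mapped to zero by \<open>A\<^sup>T\<close>, this persists near \<open>ybar\<close> with a uniform estimate
  (\<open>normal_cone_adjoint_estimate\<close>), and a penalty argument then represents every regular normal to
  the preimage of \<open>\<Theta>\<close> as the image of a normal to \<open>\<Theta>\<close>
  (\<open>regular_normal_cone_vimage_multiplier\<close>). The same observation gives uniqueness at \<open>ybar\<close>.

  The pair \<open>(u, v)\<close> satisfies \<open>v \<in> normal_cone \<Theta> u\<close> exactly if \<open>u\<close> is the projection of \<open>u + v\<close>.
  The projection is Lipschitz, so the projection derivation condition identifies the first-order
  variations of normal pairs with the pairs \<open>(w, m)\<close>, \<open>m\<close> normal at \<open>w\<close> to the critical cone \<open>K\<close>
  (\<open>normal_cone_variation_limit\<close>, \<open>normal_cone_variation_exists\<close>).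

  Sufficiency. If isolated calmness fails, there are solutions \<open>y\<close> with \<open>|x - xbar| = o(|y - ybar|)\<close>.
  Dividing the deviations of \<open>y\<close> and of its multiplier by the sum of their norms and passing to
  a limit gives \<open>(v, m) \<noteq> 0\<close> with \<open>m \<in> normal_cone K (A v)\<close> that solves the linearized equation.
  If \<open>v = 0\<close>, then \<open>A\<^sup>T m = 0\<close> and \<open>m\<close> annihilates \<open>L \<subseteq> K\<close>, so \<open>m = 0\<close>; hence \<open>v \<noteq> 0\<close> solves the
  adjoint equation.

  Necessity. Let \<open>v\<close>, with normal \<open>m\<close>, solve the adjoint equation. The variation \<open>(A v, m)\<close> is
  realized by normal pairs of \<open>\<Theta>\<close> whose first component need not be a value of \<open>g\<close>. The pointed
  reduction corrects this: the derivative of the reducing map \<open>\<eta>\<close> vanishes on \<open>L\<close>, so \<open>\<eta> \<circ> g\<close> is a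
  submersion, and the pairs can be moved to \<open>g y\<close> with \<open>y = ybar + t v + o(t)\<close> at the cost of \<open>o(t)\<close>
  (\<open>normal_variation_lift_reduction\<close>). The residual of the equation is then \<open>o(t)\<close> and is removed
  by a change of \<open>x\<close> of order \<open>o(t)\<close>, since \<open>f\<close> is a submersion in \<open>x\<close>. Isolated calmness gives
  \<open>|y - ybar| = o(t)\<close>, that is \<open>v = 0\<close>.\<close>

section \<open>Difference quotients along sequences\<close>

text \<open>A derivative may be evaluated along any sequence of directions that converges.\<close>

lemma has_derivative_sequentially:
  fixes f :: "'a::real_normed_vector \<Rightarrow> 'b::real_normed_vector"
  assumes f: "(f has_derivative f') (at p)"
    and t: "\<And>k. 0 < t k" "t \<longlonglongrightarrow> (0::real)" and w: "w \<longlonglongrightarrow> v"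
  shows "(\<lambda>k. (f (p + t k *\<^sub>R w k) - f p) /\<^sub>R t k) \<longlonglongrightarrow> f' v"
proof -
  define r where "r h = norm (f (p + h) - f p - f' h) / norm h" for h
  have bl: "bounded_linear f'" and "r \<midarrow>0\<rightarrow> 0"
    using f unfolding has_derivative_at r_def by auto
  moreover have "r 0 = 0" by (simp add: r_def)
  ultimately have "isCont r 0" by (simp add: isCont_def)
  moreover have "(\<lambda>k. t k *\<^sub>R w k) \<longlonglongrightarrow> 0"
    using tendsto_scaleR[OF t(2) w] by simp
  ultimately have "(\<lambda>k. r (t k *\<^sub>R w k)) \<longlonglongrightarrow> r 0"
    by (rule isCont_tendsto_compose)
  then have "(\<lambda>k. r (t k *\<^sub>R w k)) \<longlonglongrightarrow> 0"
    by (simp only: \<open>r 0 = 0\<close>)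
  from tendsto_mult[OF this tendsto_norm[OF w]]
  have lim: "(\<lambda>k. r (t k *\<^sub>R w k) * norm (w k)) \<longlonglongrightarrow> 0" by simp
  have eq: "norm ((f (p + t k *\<^sub>R w k) - f p) /\<^sub>R t k - f' (w k)) = r (t k *\<^sub>R w k) * norm (w k)" for k
  proof (cases "w k = 0")
    case True
    then show ?thesis using linear_0[OF bounded_linear.linear[OF bl]] by simp
  next
    case False
    have "(f (p + t k *\<^sub>R w k) - f p) /\<^sub>R t k - f' (w k)
        = (f (p + t k *\<^sub>R w k) - f p - f' (t k *\<^sub>R w k)) /\<^sub>R t k"
      using t(1)[of k] linear_cmul[OF bounded_linear.linear[OF bl]]
      by (simp add: scaleR_diff_right)
    then show ?thesis using t(1)[of k] False by (simp add: r_def divide_simps)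
  qed
  have "(\<lambda>k. (f (p + t k *\<^sub>R w k) - f p) /\<^sub>R t k - f' (w k)) \<longlonglongrightarrow> 0"
    by (rule tendsto_norm_zero_cancel) (simp add: eq lim)
  from tendsto_add[OF this bounded_linear.tendsto[OF bl w]] show ?thesis by simp
qed

text \<open>For Lipschitz maps the same is true of directional derivatives.\<close>

lemma has_dir_derivative_sequentially:
  fixes f :: "'a::real_normed_vector \<Rightarrow> 'b::real_normed_vector"
  assumes f: "has_dir_derivative f p h d" and lip: "\<And>a b. dist (f a) (f b) \<le> C * dist a b"
    and t: "\<And>k. 0 < t k" "t \<longlonglongrightarrow> (0::real)" and w: "w \<longlonglongrightarrow> h"
  shows "(\<lambda>k. (f (p + t k *\<^sub>R w k) - f p) /\<^sub>R t k) \<longlonglongrightarrow> d"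
proof -
  have "filterlim t (at_right 0) sequentially"
    using t by (auto simp: filterlim_at less_imp_neq[symmetric])
  then have 1: "(\<lambda>k. (f (p + t k *\<^sub>R h) - f p) /\<^sub>R t k) \<longlonglongrightarrow> d"
    using f unfolding has_dir_derivative_def by (rule filterlim_compose[rotated])
  have 2: "(\<lambda>k. (f (p + t k *\<^sub>R w k) - f (p + t k *\<^sub>R h)) /\<^sub>R t k) \<longlonglongrightarrow> 0"
  proof (rule Lim_null_comparison)
    show "(\<lambda>k. C * norm (w k - h)) \<longlonglongrightarrow> 0"
      using tendsto_mult_right_zero[OF tendsto_norm_zero[OF LIM_zero[OF w]]] by simp
    show "\<forall>\<^sub>F k in sequentially.
        norm ((f (p + t k *\<^sub>R w k) - f (p + t k *\<^sub>R h)) /\<^sub>R t k) \<le> C * norm (w k - h)"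
    proof (rule always_eventually, rule allI)
      fix k
      have "norm (f (p + t k *\<^sub>R w k) - f (p + t k *\<^sub>R h)) \<le> C * norm (t k *\<^sub>R (w k - h))"
        using lip[of "p + t k *\<^sub>R w k" "p + t k *\<^sub>R h"] by (simp add: dist_norm scaleR_diff_right)
      also have "\<dots> = t k * (C * norm (w k - h))" using t(1)[of k] by simp
      finally show "norm ((f (p + t k *\<^sub>R w k) - f (p + t k *\<^sub>R h)) /\<^sub>R t k) \<le> C * norm (w k - h)"
        using t(1)[of k] by (simp add: divide_simps mult.commute)
    qed
  qed
  from tendsto_add[OF 2 1] show ?thesis by (simp flip: scaleR_add_right)
qed

lemma has_derivative_lower_bound:
  fixes f :: "'a::real_normed_vector \<Rightarrow> real"
  assumes f: "(f has_derivative f') (at p)" and "0 < r"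
    and le: "\<And>u. norm (u - p) < r \<Longrightarrow> f p - c * norm (u - p) \<le> f u"
  shows "- c * norm h \<le> f' h"
proof -
  let ?t = "\<lambda>k. 1 / real (Suc k)"
  have t: "?t \<longlonglongrightarrow> 0" by (rule LIMSEQ_Suc[OF lim_1_over_n])
  then have lim: "(\<lambda>k. (f (p + ?t k *\<^sub>R h) - f p) /\<^sub>R ?t k) \<longlonglongrightarrow> f' h"
    by (intro has_derivative_sequentially[OF f]) auto
  have "(\<lambda>k. ?t k *\<^sub>R h) \<longlonglongrightarrow> 0" using tendsto_scaleR[OF t tendsto_const] by simp
  then have "\<forall>\<^sub>F k in sequentially. norm (?t k *\<^sub>R h) < r"
    using \<open>0 < r\<close> by (auto simp: tendsto_iff)
  then have "\<forall>\<^sub>F k in sequentially. - c * norm h \<le> (f (p + ?t k *\<^sub>R h) - f p) /\<^sub>R ?t k"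
  proof eventually_elim
    case (elim k)
    have "f p - c * (?t k * norm h) \<le> f (p + ?t k *\<^sub>R h)"
      using le[of "p + ?t k *\<^sub>R h"] elim by simp
    then have "- c * (?t k * norm h) \<le> f (p + ?t k *\<^sub>R h) - f p" by linarith
    then have "(- c * (?t k * norm h)) /\<^sub>R ?t k \<le> (f (p + ?t k *\<^sub>R h) - f p) /\<^sub>R ?t k"
      by (intro scaleR_left_mono) auto
    then show ?case by simp
  qed
  with lim show ?thesis by (intro tendsto_lowerbound) auto
qed

section \<open>Normal cones, tangent cones and critical cones\<close>

lemma normal_cone_iff: "v \<in> normal_cone C z \<longleftrightarrow> z \<in> C \<and> (\<forall>u\<in>C. v \<bullet> (u - z) \<le> 0)"
  by (auto simp: normal_cone_def)

lemma normal_cone_scale: "v \<in> normal_cone C z \<Longrightarrow> 0 \<le> c \<Longrightarrow> c *\<^sub>R v \<in> normal_cone C z"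
  by (auto simp: normal_cone_iff mult_nonneg_nonpos)

lemma normal_cone_closed_graph:
  assumes "closed C" and v: "v \<longlonglongrightarrow> v'" and z: "z \<longlonglongrightarrow> z'"
    and n: "\<And>k. v k \<in> normal_cone C (z k)"
  shows "v' \<in> normal_cone C z'"
proof -
  have "z' \<in> C"
    using closed_sequentially[OF \<open>closed C\<close> _ z] n by (simp add: normal_cone_iff)
  moreover have "v' \<bullet> (u - z') \<le> 0" if "u \<in> C" for u
  proof (rule tendsto_upperbound)
    show "(\<lambda>k. v k \<bullet> (u - z k)) \<longlonglongrightarrow> v' \<bullet> (u - z')" by (intro tendsto_intros v z)
  qed (use n that in \<open>auto simp: normal_cone_iff\<close>)
  ultimately show ?thesis by (simp add: normal_cone_iff)
qed

lemma normal_cone_interior: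
  fixes C :: "'a::real_inner set"
  assumes "v \<in> normal_cone C z" "z \<in> interior C"
  shows "v = 0"
proof (rule ccontr)
  assume "v \<noteq> 0"
  obtain e where e: "0 < e" "cball z e \<subseteq> C"
    using assms(2) by (auto simp: mem_interior_cball)
  then have "z + (e / norm v) *\<^sub>R v \<in> C" using \<open>v \<noteq> 0\<close> by (auto simp: dist_norm)
  then have "v \<bullet> ((e / norm v) *\<^sub>R v) \<le> 0" using assms(1) by (auto simp: normal_cone_iff)
  then have "e / norm v * (v \<bullet> v) \<le> 0" by simp
  moreover have "0 < e / norm v * (v \<bullet> v)" using e(1) \<open>v \<noteq> 0\<close> by simp
  ultimately show False by linarith
qed

lemma closest_point_eq_iff_normal_cone:
  fixes C :: "'a::euclidean_space set"
  assumes "closed C" "convex C" "p \<in> C"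
  shows "closest_point C (p + v) = p \<longleftrightarrow> v \<in> normal_cone C p"
proof
  assume eq: "closest_point C (p + v) = p"
  show "v \<in> normal_cone C p"
    using closest_point_dot[OF assms(2,1), of _ "p + v"] assms(3)
    by (auto simp: eq normal_cone_iff)
next
  assume n: "v \<in> normal_cone C p"
  show "closest_point C (p + v) = p"
  proof (rule closest_point_unique[OF assms(2,1,3), symmetric], rule ballI)
    fix u assume "u \<in> C"
    then have "v \<bullet> (u - p) \<le> 0" using n by (simp add: normal_cone_iff)
    moreover have "(norm (v - w))\<^sup>2 = (norm v)\<^sup>2 - 2 * (v \<bullet> w) + (norm w)\<^sup>2" for w
      by (simp add: power2_norm_eq_inner inner_diff_left inner_diff_right inner_commute)
    ultimately have "(norm v)\<^sup>2 \<le> (norm (v - (u - p)))\<^sup>2"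
      by (smt (verit) zero_le_power2)
    then have "norm v \<le> norm (v - (u - p))" by (rule power2_le_imp_le) simp
    then show "dist (p + v) p \<le> dist (p + v) u" by (simp add: dist_norm algebra_simps)
  qed
qed

lemma closest_point_normal_cone:
  fixes C :: "'a::euclidean_space set"
  assumes "closed C" "convex C" "C \<noteq> {}"
  shows "a - closest_point C a \<in> normal_cone C (closest_point C a)"
  using closest_point_dot[OF assms(2,1)] closest_point_in_set[OF assms(1,3)]
  by (auto simp: normal_cone_iff)

lemma tangent_coneI:
  assumes "\<And>k::nat. 0 < t k" "t \<longlonglongrightarrow> 0" "u \<longlonglongrightarrow> w" "\<And>k. z + t k *\<^sub>R u k \<in> C"
  shows "w \<in> tangent_cone C z"
  using assms by (auto simp: tangent_cone_def)

lemma tangent_coneE: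
  assumes "w \<in> tangent_cone C z"
  obtains t u where "\<And>k::nat. 0 < t k" "t \<longlonglongrightarrow> 0" "u \<longlonglongrightarrow> w" "\<And>k. z + t k *\<^sub>R u k \<in> C"
  using assms by (auto simp: tangent_cone_def)

lemma normal_cone_tangent_cone:
  assumes "v \<in> normal_cone C z" "w \<in> tangent_cone C z"
  shows "v \<bullet> w \<le> 0"
proof -
  obtain t u where t: "\<And>k::nat. 0 < t k" "u \<longlonglongrightarrow> w" "\<And>k. z + t k *\<^sub>R u k \<in> C"
    using tangent_coneE[OF assms(2)] by metis
  have "v \<bullet> u k \<le> 0" for k
  proof -
    have "v \<bullet> (t k *\<^sub>R u k) \<le> 0" using assms(1) t(3)[of k] by (force simp: normal_cone_iff)
    then show ?thesis using t(1)[of k] by (simp add: mult_le_0_iff)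
  qed
  moreover have "(\<lambda>k. v \<bullet> u k) \<longlonglongrightarrow> v \<bullet> w" by (intro tendsto_intros t(2))
  ultimately show ?thesis by (intro tendsto_upperbound) auto
qed

lemma tangent_cone_convex_eq:
  fixes C :: "'a::real_normed_vector set"
  assumes "convex C" "z \<in> C"
  shows "tangent_cone C z = closure (cone hull ((\<lambda>u. u - z) ` C))" (is "_ = closure ?H")
proof (intro set_eqI iffI)
  fix w assume "w \<in> tangent_cone C z"
  then obtain t u where t: "\<And>k::nat. 0 < t k" "u \<longlonglongrightarrow> w" "\<And>k. z + t k *\<^sub>R u k \<in> C"
    using tangent_coneE by metis
  have "u k \<in> ?H" for k
  proof -
    have "t k *\<^sub>R u k \<in> (\<lambda>u. u - z) ` C" using t(3)[of k] by force
    moreover have "u k = (1 / t k) *\<^sub>R (t k *\<^sub>R u k)" using t(1)[of k] by simp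
    moreover have "0 \<le> 1 / t k" using t(1)[of k] by simp
    ultimately show ?thesis unfolding cone_hull_expl by blast
  qed
  then show "w \<in> closure ?H" using t(2) closure_sequential by blast
next
  fix w assume "w \<in> closure ?H"
  then obtain c where c: "\<And>k::nat. c k \<in> ?H" "c \<longlonglongrightarrow> w"
    unfolding closure_sequential by auto
  have "\<forall>k. \<exists>s p. 0 \<le> s \<and> p \<in> C \<and> c k = s *\<^sub>R (p - z)"
  proof
    fix k
    obtain s x where "c k = s *\<^sub>R x" "0 \<le> s" "x \<in> (\<lambda>u. u - z) ` C"
      using c(1)[of k] unfolding cone_hull_expl by blast
    then show "\<exists>s p. 0 \<le> s \<and> p \<in> C \<and> c k = s *\<^sub>R (p - z)" by blast
  qed
  then obtain s p where s: "\<And>k. 0 \<le> s k" "\<And>k. p k \<in> C" "\<And>k. c k = s k *\<^sub>R (p k - z)"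
    by metis
  \<comment> \<open>steps so short that they stay on the segments from \<open>z\<close> to \<open>p k\<close>\<close>
  define t where "t k = 1 / (real (Suc k) * (1 + s k))" for k
  have tpos: "0 < t k" for k using s(1)[of k] by (simp add: t_def add_pos_nonneg)
  have tle: "t k \<le> 1 / real (Suc k)" for k
  proof -
    have "real (Suc k) * 1 \<le> real (Suc k) * (1 + s k)"
      using s(1)[of k] by (intro mult_left_mono) auto
    then show ?thesis unfolding t_def by (intro divide_left_mono) (use s(1)[of k] in auto)
  qed
  have "t \<longlonglongrightarrow> 0"
    by (rule tendsto_sandwich[OF _ _ tendsto_const LIMSEQ_Suc[OF lim_1_over_n]])
      (use tpos tle in \<open>auto intro!: always_eventually less_imp_le\<close>)
  moreover have "z + t k *\<^sub>R c k \<in> C" for k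
  proof -
    have "t k * s k \<le> 1"
    proof -
      have "s k \<le> real (Suc k) * (1 + s k)"
        using mult_mono[of 1 "real (Suc k)" "s k" "1 + s k"] s(1)[of k] by simp
      moreover have "0 < real (Suc k) * (1 + s k)" using s(1)[of k] by simp
      ultimately show ?thesis by (simp add: t_def)
    qed
    moreover have "0 \<le> t k * s k" using tpos[of k] s(1)[of k] by simp
    ultimately have "(1 - t k * s k) *\<^sub>R z + (t k * s k) *\<^sub>R p k \<in> C"
      using assms s(2)[of k] by (intro convexD) auto
    then show ?thesis by (simp add: s(3) algebra_simps)
  qed
  ultimately show "w \<in> tangent_cone C z" using tpos c(2) by (intro tangent_coneI)
qed

lemma
  fixes C :: "'a::real_normed_vector set"
  assumes "convex C" "z \<in> C"
  shows closed_tangent_cone: "closed (tangent_cone C z)"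
    and convex_tangent_cone: "convex (tangent_cone C z)"
    and cone_tangent_cone: "cone (tangent_cone C z)"
    and zero_in_tangent_cone: "0 \<in> tangent_cone C z"
proof -
  note eq = tangent_cone_convex_eq[OF assms]
  show "closed (tangent_cone C z)" by (simp add: eq)
  have "convex ((\<lambda>u. u - z) ` C)" using assms(1) by (rule convex_translation_subtract)
  then show "convex (tangent_cone C z)"
    by (simp add: eq convex_closure convex_cone_hull)
  show *: "cone (tangent_cone C z)"
    by (simp add: eq cone_closure cone_cone_hull)
  show "0 \<in> tangent_cone C z"
    by (rule tangent_coneI[OF _ LIMSEQ_Suc[OF lim_1_over_n] tendsto_const]) (use assms(2) in auto)
qed

text \<open>The lineality space of a convex cone \<open>K\<close> is \<open>K \<inter> - K\<close>.\<close>

lemma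
  fixes K :: "'a::real_vector set"
  assumes "convex K" "cone K" "0 \<in> K"
  shows subspace_lin: "subspace (lin K)" and lin_subset: "lin K \<subseteq> K"
proof -
  define L where "L = K \<inter> uminus ` K"
  have add: "x + y \<in> K" if "x \<in> K" "y \<in> K" for x y
    using assms that convex_cone by blast
  have mem: "x \<in> L \<longleftrightarrow> x \<in> K \<and> - x \<in> K" for x by (force simp: L_def)
  have scale: "c *\<^sub>R x \<in> L" if "x \<in> L" for c x
  proof (cases "0 \<le> c")
    case True
    then have "c *\<^sub>R x \<in> K" "c *\<^sub>R (- x) \<in> K"
      using that mem_cone[OF assms(2)] unfolding mem by blast+
    then show ?thesis by (simp add: mem)
  next
    case False
    then have "(- c) *\<^sub>R x \<in> K" "(- c) *\<^sub>R (- x) \<in> K"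
      using that mem_cone[OF assms(2)] unfolding mem by (meson linear neg_0_le_iff_le)+
    then show ?thesis by (simp add: mem)
  qed
  have "x + y \<in> L" if "x \<in> L" "y \<in> L" for x y
    using that add[of x y] add[of "- x" "- y"] by (simp add: mem)
  then have L: "subspace L" using assms(3) scale by (auto simp: subspace_def mem)
  have "lin K = L"
    unfolding lin_def
  proof (rule Greatest_equality)
    show "subspace L \<and> L \<subseteq> K" using L by (simp add: L_def)
    show "M \<le> L" if "subspace M \<and> M \<subseteq> K" for M
      using that subspace_neg by (fastforce simp: mem)
  qed
  then show "subspace (lin K)" "lin K \<subseteq> K" using L by (auto simp: L_def)
qed

lemma normal_cone_orthogonal_lin:
  fixes C :: "'a::euclidean_space set"
  assumes "convex C" "v \<in> normal_cone C z" "w \<in> lin (tangent_cone C z)"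
  shows "v \<bullet> w = 0"
proof -
  have z: "z \<in> C" using assms(2) by (simp add: normal_cone_iff)
  note T = convex_tangent_cone[OF assms(1) z] cone_tangent_cone[OF assms(1) z]
    zero_in_tangent_cone[OF assms(1) z]
  have "- w \<in> lin (tangent_cone C z)" using subspace_neg[OF subspace_lin[OF T]] assms(3) .
  then have "w \<in> tangent_cone C z" "- w \<in> tangent_cone C z" using lin_subset[OF T] assms(3) by auto
  then show ?thesis
    using normal_cone_tangent_cone[OF assms(2), of w] normal_cone_tangent_cone[OF assms(2), of "- w"]
    by simp
qed

lemma
  fixes C :: "'a::euclidean_space set"
  assumes "convex C" "b \<in> normal_cone C z"
  shows closed_critical_cone: "closed (critical_cone C z b)"
    and convex_critical_cone: "convex (critical_cone C z b)"
    and zero_in_critical_cone: "0 \<in> critical_cone C z b"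
    and lin_subset_critical_cone: "lin (tangent_cone C z) \<subseteq> critical_cone C z b"
proof -
  have z: "z \<in> C" using assms(2) by (simp add: normal_cone_iff)
  note T = convex_tangent_cone[OF assms(1) z] cone_tangent_cone[OF assms(1) z]
    zero_in_tangent_cone[OF assms(1) z]
  show "closed (critical_cone C z b)" "convex (critical_cone C z b)"
    unfolding critical_cone_def
    by (intro closed_Int convex_Int closed_tangent_cone[OF assms(1) z] T closed_hyperplane
        convex_hyperplane)+
  show "0 \<in> critical_cone C z b" using T by (simp add: critical_cone_def)
  show "lin (tangent_cone C z) \<subseteq> critical_cone C z b"
    using lin_subset[OF T] normal_cone_orthogonal_lin[OF assms] by (auto simp: critical_cone_def)
qed

section \<open>Adjoints of bounded linear maps\<close>

lemma adjoint_blinfun: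
  fixes B :: "'a::euclidean_space \<Rightarrow>\<^sub>L 'b::euclidean_space"
  shows "adjoint B y \<bullet> x = y \<bullet> B x" "x \<bullet> adjoint B y = B x \<bullet> y"
proof -
  have "linear (blinfun_apply B)" by (rule bounded_linear.linear[OF blinfun.bounded_linear_right])
  from adjoint_clauses[OF this]
  show "adjoint B y \<bullet> x = y \<bullet> B x" "x \<bullet> adjoint B y = B x \<bullet> y" by auto
qed

lemma norm_adjoint_le:
  fixes B :: "'a::euclidean_space \<Rightarrow>\<^sub>L 'b::euclidean_space"
  shows "norm (adjoint (blinfun_apply B) y) \<le> norm B * norm y"
proof -
  let ?n = "norm (adjoint (blinfun_apply B) y)"
  have "?n * ?n = y \<bullet> B (adjoint B y)"
    by (simp add: norm_eq_sqrt_inner adjoint_blinfun flip: adjoint_blinfun)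
  also have "\<dots> \<le> norm y * (norm B * ?n)"
    by (rule order_trans[OF norm_cauchy_schwarz mult_left_mono[OF norm_blinfun]]) simp
  finally have "?n * ?n \<le> (norm B * norm y) * ?n" by (simp add: mult_ac)
  then show ?thesis by (cases "?n = 0") (auto simp: mult_le_cancel_right)
qed

lemma bounded_bilinear_adjoint:
  "bounded_bilinear (\<lambda>B::'a::euclidean_space \<Rightarrow>\<^sub>L 'b::euclidean_space. adjoint B)"
proof
  fix B B' :: "'a \<Rightarrow>\<^sub>L 'b" and y y' :: 'b and r :: real
  show "adjoint (B + B') y = adjoint B y + adjoint B' y"
    by (rule vector_eq_ldot[THEN iffD1])
      (simp add: adjoint_blinfun inner_add_left inner_add_right blinfun.add_left)
  show "adjoint B (y + y') = adjoint B y + adjoint B y'"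
    by (rule vector_eq_ldot[THEN iffD1])
      (simp add: adjoint_blinfun inner_add_left inner_add_right)
  show "adjoint (r *\<^sub>R B) y = r *\<^sub>R adjoint B y"
    by (rule vector_eq_ldot[THEN iffD1]) (simp add: adjoint_blinfun blinfun.scaleR_left)
  show "adjoint B (r *\<^sub>R y) = r *\<^sub>R adjoint B y"
    by (rule vector_eq_ldot[THEN iffD1]) (simp add: adjoint_blinfun)
  show "\<exists>K. \<forall>(B::'a \<Rightarrow>\<^sub>L 'b) y. norm (adjoint (blinfun_apply B) y) \<le> norm B * norm y * K"
    by (rule exI[of _ 1]) (simp add: norm_adjoint_le)
qed

lemmas tendsto_adjoint [tendsto_intros] = bounded_bilinear.tendsto[OF bounded_bilinear_adjoint]

text \<open>If the kernel of the adjoint meets the normal cone only in the origin, then normals are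
  bounded by their images, uniformly near the reference point. For \<open>C = {z}\<close>, whose normal cone
  at \<open>z\<close> is the whole space, this says that adjoints near an injective one are injective.\<close>

lemma normal_cone_adjoint_estimate:
  fixes G :: "'p::metric_space \<Rightarrow> 'a::euclidean_space \<Rightarrow>\<^sub>L 'b::euclidean_space"
  assumes "closed C" "isCont G p"
    and cq: "\<And>v. v \<in> normal_cone C z \<Longrightarrow> adjoint (G p) v = 0 \<Longrightarrow> v = 0"
  obtains d c where "0 < d" "0 < c"
    "\<And>y u v. dist y p < d \<Longrightarrow> dist u z < d \<Longrightarrow> v \<in> normal_cone C u
      \<Longrightarrow> norm v \<le> c * norm (adjoint (G y) v)"
proof (rule ccontr)
  assume no: "\<not> thesis"
  have "\<exists>y u v. dist y p < 1 / real (Suc k) \<and> dist u z < 1 / real (Suc k) \<and>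
    v \<in> normal_cone C u \<and> real (Suc k) * norm (adjoint (G y) v) < norm v" for k
  proof (rule ccontr)
    assume "\<not> ?thesis"
    then have "norm v \<le> real (Suc k) * norm (adjoint (G y) v)"
      if "dist y p < 1 / real (Suc k)" "dist u z < 1 / real (Suc k)" "v \<in> normal_cone C u" for y u v
      using that not_le by blast
    then show False using no that[of "1 / real (Suc k)" "real (Suc k)"] by simp
  qed
  then obtain y u v where y: "\<And>k. dist (y k) p < 1 / real (Suc k)"
    and u: "\<And>k. dist (u k) z < 1 / real (Suc k)"
    and v: "\<And>k. v k \<in> normal_cone C (u k)"
    and vn: "\<And>k. real (Suc k) * norm (adjoint (G (y k)) (v k)) < norm (v k)"
    by metis
  have lim0: "(\<lambda>k. 1 / real (Suc k)) \<longlonglongrightarrow> 0" by (rule LIMSEQ_Suc[OF lim_1_over_n])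
  have ylim: "y \<longlonglongrightarrow> p"
    by (rule metric_tendsto_imp_tendsto[OF lim0]) (use y in \<open>auto intro!: always_eventually less_imp_le\<close>)
  have ulim: "u \<longlonglongrightarrow> z"
    by (rule metric_tendsto_imp_tendsto[OF lim0]) (use u in \<open>auto intro!: always_eventually less_imp_le\<close>)
  have v0: "v k \<noteq> 0" for k
    using vn[of k] by (auto simp: mult_less_0_iff)
  define n where "n k = (1 / norm (v k)) *\<^sub>R v k" for k
  have n1: "norm (n k) = 1" for k using v0[of k] by (simp add: n_def)
  have nN: "n k \<in> normal_cone C (u k)" for k
    unfolding n_def using v[of k] by (rule normal_cone_scale) simp
  have na: "norm (adjoint (G (y k)) (n k)) \<le> 1 / real (Suc k)" for k
  proof -
    have "adjoint (G (y k)) (n k) = (1 / norm (v k)) *\<^sub>R adjoint (G (y k)) (v k)"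
      unfolding n_def by (rule bounded_bilinear.scaleR_right[OF bounded_bilinear_adjoint])
    then have "norm (adjoint (G (y k)) (n k)) = norm (adjoint (G (y k)) (v k)) / norm (v k)"
      by simp
    moreover have "norm (adjoint (G (y k)) (v k)) / norm (v k) < 1 / real (Suc k)"
      using vn[of k] v0[of k] by (simp only: divide_simps) (simp add: mult.commute)
    ultimately show ?thesis by linarith
  qed
  have "compact (sphere 0 1 :: 'b set)" by simp
  then obtain n' r where n': "n' \<in> sphere 0 1" and r: "strict_mono (r :: nat \<Rightarrow> nat)"
    and lim: "(n \<circ> r) \<longlonglongrightarrow> n'"
    unfolding compact_def using n1 by (metis dist_0_norm mem_sphere)
  note sub = LIMSEQ_subseq_LIMSEQ[OF _ r, unfolded comp_def]
  have nlim: "(\<lambda>k. n (r k)) \<longlonglongrightarrow> n'" using lim by (simp add: comp_def)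
  have "n' \<in> normal_cone C z"
    by (rule normal_cone_closed_graph[OF \<open>closed C\<close> nlim sub[OF ulim]]) (rule nN)
  moreover have "adjoint (G p) n' = 0"
  proof (rule LIMSEQ_unique)
    show "(\<lambda>k. adjoint (G (y (r k))) (n (r k))) \<longlonglongrightarrow> adjoint (G p) n'"
      by (intro tendsto_intros nlim isCont_tendsto_compose[OF \<open>isCont G p\<close> sub[OF ylim]])
    show "(\<lambda>k. adjoint (G (y (r k))) (n (r k))) \<longlonglongrightarrow> 0"
      by (rule Lim_null_comparison[OF _ sub[OF lim0]]) (use na in \<open>auto intro!: always_eventually\<close>)
  qed
  ultimately have "n' = 0" by (rule cq)
  with n' show False by simp
qed

section \<open>Regular normals to a preimage\<close>

lemma regular_normal_cone_iff:
  "v \<in> regular_normal_cone \<Omega> y \<longleftrightarrow> y \<in> \<Omega> \<and>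
    (\<forall>e>0. \<exists>d>0. \<forall>u\<in>\<Omega>. norm (u - y) < d \<longrightarrow> v \<bullet> (u - y) \<le> e * norm (u - y))"
proof (cases "y \<in> \<Omega>")
  case True
  let ?q = "\<lambda>u. v \<bullet> (u - y) / norm (u - y)"
  have "v \<in> regular_normal_cone \<Omega> y \<longleftrightarrow> Limsup (at y within \<Omega>) (\<lambda>u. ereal (?q u)) \<le> 0"
    using True by (simp add: regular_normal_cone_def)
  also have "\<dots> \<longleftrightarrow> (\<forall>e>0. eventually (\<lambda>u. ?q u < e) (at y within \<Omega>))"
    unfolding Limsup_le_iff
  proof (intro iffI allI impI)
    fix e :: real
    assume *: "\<forall>x>0. \<forall>\<^sub>F u in at y within \<Omega>. ereal (?q u) < x" and "0 < e"
    then show "\<forall>\<^sub>F u in at y within \<Omega>. ?q u < e" using *[rule_format, of "ereal e"] by simp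
  next
    fix x :: ereal
    assume *: "\<forall>e>0. \<forall>\<^sub>F u in at y within \<Omega>. ?q u < e" and "0 < x"
    then show "\<forall>\<^sub>F u in at y within \<Omega>. ereal (?q u) < x" by (cases x) auto
  qed
  also have "\<dots> \<longleftrightarrow> (\<forall>e>0. \<exists>d>0. \<forall>u\<in>\<Omega>. norm (u - y) < d \<longrightarrow> v \<bullet> (u - y) \<le> e * norm (u - y))"
    (is "?L \<longleftrightarrow> ?R")
  proof
    assume L: ?L
    show ?R
    proof (intro allI impI)
      fix e :: real assume "0 < e"
      then obtain d where "0 < d" and d: "\<And>u. u \<in> \<Omega> \<Longrightarrow> u \<noteq> y \<Longrightarrow> dist u y < d \<Longrightarrow> ?q u < e"
        using L unfolding eventually_at by blast
      have "v \<bullet> (u - y) \<le> e * norm (u - y)" if "u \<in> \<Omega>" "norm (u - y) < d" for u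
      proof (cases "u = y")
        case False
        then show ?thesis using d[of u] that by (simp add: dist_norm divide_simps split: if_splits)
      qed simp
      then show "\<exists>d>0. \<forall>u\<in>\<Omega>. norm (u - y) < d \<longrightarrow> v \<bullet> (u - y) \<le> e * norm (u - y)"
        using \<open>0 < d\<close> by blast
    qed
  next
    assume R: ?R
    show ?L
    proof (intro allI impI)
      fix e :: real assume "0 < e"
      then obtain d where "0 < d"
        and d: "\<And>u. u \<in> \<Omega> \<Longrightarrow> norm (u - y) < d \<Longrightarrow> v \<bullet> (u - y) \<le> e / 2 * norm (u - y)"
        using R half_gt_zero by metis
      have "?q u < e" if "u \<in> \<Omega>" "u \<noteq> y" "dist u y < d" for u
      proof -
        have "?q u \<le> e / 2" using d[of u] that by (simp add: dist_norm divide_simps)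
        then show ?thesis using \<open>0 < e\<close> by linarith
      qed
      then show "\<forall>\<^sub>F u in at y within \<Omega>. ?q u < e"
        unfolding eventually_at using \<open>0 < d\<close> by blast
    qed
  qed
  finally show ?thesis using True by simp
qed (simp add: regular_normal_cone_def)

lemma adjoint_in_regular_normal_cone_vimage:
  fixes g :: "'a::euclidean_space \<Rightarrow> 'b::euclidean_space" and g' :: "'a \<Rightarrow>\<^sub>L 'b"
  assumes g: "(g has_derivative g') (at y)" and v: "v \<in> normal_cone C (g y)"
  shows "adjoint g' v \<in> regular_normal_cone (g -` C) y"
  unfolding regular_normal_cone_iff
proof (intro conjI allI impI)
  show "y \<in> g -` C" using v by (simp add: normal_cone_iff)
  fix e :: real assume "0 < e"
  define e' where "e' = e / (norm v + 1)"
  have "0 < e'" using \<open>0 < e\<close> by (simp add: e'_def add_nonneg_pos)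
  then obtain d where "0 < d"
    and d: "\<And>u. norm (u - y) < d \<Longrightarrow> norm (g u - g y - g' (u - y)) \<le> e' * norm (u - y)"
    using g unfolding has_derivative_at_alt by blast
  have "adjoint g' v \<bullet> (u - y) \<le> e * norm (u - y)" if "u \<in> g -` C" "norm (u - y) < d" for u
  proof -
    have "v \<bullet> (g u - g y) \<le> 0" using that(1) v by (simp add: normal_cone_iff)
    moreover have "- (v \<bullet> (g u - g y - g' (u - y))) \<le> norm v * (e' * norm (u - y))"
    proof -
      have "- (v \<bullet> (g u - g y - g' (u - y))) \<le> norm v * norm (g u - g y - g' (u - y))"
        using Cauchy_Schwarz_ineq2[of v "g u - g y - g' (u - y)"] by linarith
      also have "\<dots> \<le> norm v * (e' * norm (u - y))" by (intro mult_left_mono d that) simp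
      finally show ?thesis .
    qed
    moreover have "norm v * (e' * norm (u - y)) \<le> e * norm (u - y)"
    proof -
      have "norm v * e' \<le> e" using \<open>0 < e\<close> by (simp add: e'_def divide_simps add_nonneg_pos)
      then have "(norm v * e') * norm (u - y) \<le> e * norm (u - y)" by (rule mult_right_mono) simp
      then show ?thesis by (simp add: mult_ac)
    qed
    ultimately show ?thesis 
      unfolding adjoint_blinfun(1) inner_diff_right blinfun.diff_right by linarith
  qed
  then show "\<exists>d>0. \<forall>u\<in>g -` C. norm (u - y) < d \<longrightarrow> adjoint g' v \<bullet> (u - y) \<le> e * norm (u - y)"
    using \<open>0 < d\<close> by blast
qed

text \<open>Every regular normal to a preimage is approximated by images of normals at nearby points,
  without any constraint qualification. The normals come from minimizing
  \<open>2 e |u - y| - v \<bullet> (u - y) + k d(g u, C)\<^sup>2\<close> over a small ball around \<open>y\<close>: as \<open>k\<close> grows the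
  minimizers tend to \<open>y\<close>, so some of them lie inside the ball and are stationary.\<close>

lemma regular_normal_cone_vimage_fuzzy:
  fixes g :: "'a::euclidean_space \<Rightarrow> 'b::euclidean_space" and g' :: "'a \<Rightarrow> 'a \<Rightarrow>\<^sub>L 'b"
  assumes g: "\<And>y. (g has_derivative g' y) (at y)" and C: "closed C" "convex C"
    and v: "v \<in> regular_normal_cone (g -` C) y" and "0 < e"
  shows "\<exists>u z l. dist u y < e \<and> dist z (g y) < e \<and> l \<in> normal_cone C z \<and>
    norm (v - adjoint (g' u) l) \<le> 2 * e"
proof -
  have gcont: "continuous_on S g" for S
    by (intro continuous_at_imp_continuous_on ballI has_derivative_continuous[OF g])
  have y: "g y \<in> C" using v by (simp add: regular_normal_cone_iff)
  then have "C \<noteq> {}" by blast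
  define P where "P = closest_point C"
  have Pcont: "continuous_on S P" for S
    unfolding P_def by (rule continuous_on_closest_point[OF C(2,1) \<open>C \<noteq> {}\<close>])
  have PC: "P z \<in> C" for z unfolding P_def by (rule closest_point_in_set[OF C(1) \<open>C \<noteq> {}\<close>])
  have Py: "P (g y) = g y" unfolding P_def by (rule closest_point_self[OF y])
  have Pgcont: "continuous_on S (\<lambda>u. P (g u))" for S
    by (rule continuous_on_compose2[OF Pcont[of UNIV] gcont]) simp
  obtain d0 where "0 < d0"
    and d0: "\<And>u. u \<in> g -` C \<Longrightarrow> norm (u - y) < d0 \<Longrightarrow> v \<bullet> (u - y) \<le> e * norm (u - y)"
    using v \<open>0 < e\<close> unfolding regular_normal_cone_iff by metis
  have "isCont (\<lambda>u. P (g u)) y" using Pgcont[of UNIV] by (simp add: continuous_on_eq_continuous_at)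
  then obtain d1 where "0 < d1" and d1: "\<And>u. dist u y < d1 \<Longrightarrow> dist (P (g u)) (g y) < e"
    using \<open>0 < e\<close> unfolding continuous_at_eps_delta by (metis Py)
  define \<rho> where "\<rho> = min (min d0 d1) e / 2"
  have \<rho>: "0 < \<rho>" "\<rho> < d0" "\<rho> < d1" "\<rho> < e"
    using \<open>0 < d0\<close> \<open>0 < d1\<close> \<open>0 < e\<close> by (auto simp: \<rho>_def)
  define \<phi> where "\<phi> k u = 2 * e * norm (u - y) - v \<bullet> (u - y) + real k * (norm (g u - P (g u)))\<^sup>2"
    for k u
  have "\<exists>u\<in>cball y \<rho>. \<forall>w\<in>cball y \<rho>. \<phi> k u \<le> \<phi> k w" for k
    using \<rho>(1) unfolding \<phi>_def
    by (intro continuous_attains_inf continuous_intros gcont Pgcont) auto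
  then obtain m where m: "\<And>k. m k \<in> cball y \<rho>" "\<And>k w. w \<in> cball y \<rho> \<Longrightarrow> \<phi> k (m k) \<le> \<phi> k w"
    by metis
  have "\<phi> k (m k) \<le> 0" for k
    using m(2)[of y k] \<rho>(1) by (simp add: \<phi>_def Py)
  then have pen: "2 * e * norm (m k - y) - v \<bullet> (m k - y) + real k * (norm (g (m k) - P (g (m k))))\<^sup>2 \<le> 0"
    for k by (simp add: \<phi>_def)
  obtain u' r where r: "strict_mono (r :: nat \<Rightarrow> nat)" and lim: "(\<lambda>k. m (r k)) \<longlonglongrightarrow> u'"
    using compact_cball[of y \<rho>] m(1) unfolding compact_def comp_def by metis
  have u'\<rho>: "u' \<in> cball y \<rho>"
    using closed_sequentially[OF closed_cball _ lim] m(1) by blast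
  have glim: "(\<lambda>k. g (m (r k))) \<longlonglongrightarrow> g u'"
    by (rule isCont_tendsto_compose[OF has_derivative_continuous[OF g] lim])
  have Plim: "(\<lambda>k. P (g (m (r k)))) \<longlonglongrightarrow> P (g u')"
    using Pcont[of UNIV] by (intro isCont_tendsto_compose[OF _ glim]) (simp add: continuous_on_eq_continuous_at)
  have "g u' - P (g u') = 0"
  proof -
    have "(\<lambda>k. (norm (g (m (r k)) - P (g (m (r k)))))\<^sup>2) \<longlonglongrightarrow> 0"
    proof (rule Lim_null_comparison)
      have "(\<lambda>k. norm v * \<rho> * (1 / real k)) \<longlonglongrightarrow> 0"
        by (rule tendsto_mult_right_zero[OF lim_1_over_n])
      from LIMSEQ_subseq_LIMSEQ[OF this r]
      show "(\<lambda>k. norm v * \<rho> * (1 / real (r k))) \<longlonglongrightarrow> 0" by (simp add: comp_def)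
      show "\<forall>\<^sub>F k in sequentially. norm ((norm (g (m (r k)) - P (g (m (r k)))))\<^sup>2)
          \<le> norm v * \<rho> * (1 / real (r k))"
        using eventually_gt_at_top[of 0]
      proof eventually_elim
        case (elim k)
        let ?D = "(norm (g (m (r k)) - P (g (m (r k)))))\<^sup>2"
        have "0 < r k" using elim seq_suble[OF r, of k] by linarith
        have "v \<bullet> (m (r k) - y) \<le> norm v * norm (m (r k) - y)" by (rule norm_cauchy_schwarz)
        also have "\<dots> \<le> norm v * \<rho>"
          using m(1)[of "r k"] by (intro mult_left_mono) (auto simp: dist_norm norm_minus_commute)
        finally have "v \<bullet> (m (r k) - y) \<le> norm v * \<rho>" .
        moreover have "0 \<le> 2 * e * norm (m (r k) - y)" using \<open>0 < e\<close> by simp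
        ultimately have "real (r k) * ?D \<le> norm v * \<rho>" using pen[of "r k"] by linarith
        then show ?case using \<open>0 < r k\<close> by (simp add: field_simps)
      qed
    qed
    moreover have "(\<lambda>k. (norm (g (m (r k)) - P (g (m (r k)))))\<^sup>2) \<longlonglongrightarrow> (norm (g u' - P (g u')))\<^sup>2"
      by (intro tendsto_intros glim Plim)
    ultimately show ?thesis using LIMSEQ_unique by fastforce
  qed
  then have "u' \<in> g -` C" using PC[of "g u'"] by simp
  then have "v \<bullet> (u' - y) \<le> e * norm (u' - y)"
    using d0 u'\<rho> \<rho>(2) by (simp add: dist_norm norm_minus_commute)
  moreover have "2 * e * norm (u' - y) - v \<bullet> (u' - y) \<le> 0"
  proof (rule tendsto_upperbound)
    show "(\<lambda>k. 2 * e * norm (m (r k) - y) - v \<bullet> (m (r k) - y))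
        \<longlonglongrightarrow> 2 * e * norm (u' - y) - v \<bullet> (u' - y)"
      by (intro tendsto_intros lim)
    show "\<forall>\<^sub>F k in sequentially. 2 * e * norm (m (r k) - y) - v \<bullet> (m (r k) - y) \<le> 0"
    proof (rule always_eventually, rule allI)
      fix k
      have "0 \<le> real (r k) * (norm (g (m (r k)) - P (g (m (r k)))))\<^sup>2" by simp
      then show "2 * e * norm (m (r k) - y) - v \<bullet> (m (r k) - y) \<le> 0" using pen[of "r k"] by linarith
    qed
  qed simp
  ultimately have "e * norm (u' - y) \<le> 0" by linarith
  then have "u' = y" using \<open>0 < e\<close> by (simp add: mult_le_0_iff)
  then have "\<forall>\<^sub>F k in sequentially. dist (m (r k)) y < \<rho>"
    using lim \<rho>(1) by (auto simp: tendsto_iff)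
  then obtain k where "dist (m (r k)) y < \<rho>" by (auto simp: eventually_sequentially)
  define n u where "n = r k" and "u = m n"
  have u: "dist u y < \<rho>" using \<open>dist (m (r k)) y < \<rho>\<close> by (simp add: u_def n_def)
  define l where "l = (2 * real n) *\<^sub>R (g u - P (g u))"
  have "l \<in> normal_cone C (P (g u))"
    unfolding l_def P_def
    by (intro normal_cone_scale closest_point_normal_cone C \<open>C \<noteq> {}\<close>) simp
  moreover have "norm (v - adjoint (g' u) l) \<le> 2 * e"
  proof -
    \<comment> \<open>freezing the projected point makes the penalty differentiable and only increases it\<close>
    define \<theta> where "\<theta> w = real n * ((g w - P (g u)) \<bullet> (g w - P (g u))) - v \<bullet> w" for w
    have d\<theta>: "(\<theta> has_derivative (\<lambda>h. l \<bullet> g' u h - v \<bullet> h)) (at u)"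
      unfolding \<theta>_def
      by (auto intro!: derivative_eq_intros g simp: l_def inner_commute)
    have "\<theta> u - 2 * e * norm (w - u) \<le> \<theta> w" if "norm (w - u) < \<rho> - dist u y" for w
    proof -
      have "dist w y \<le> \<rho>" using that dist_triangle[of w y u] by (simp add: dist_norm)
      then have "\<phi> n u \<le> \<phi> n w"
        unfolding u_def by (intro m(2)) (simp add: dist_commute)
      moreover have "real n * (norm (g w - P (g w)))\<^sup>2 \<le> real n * (norm (g w - P (g u)))\<^sup>2"
        using closest_point_le[OF C(1) PC[of "g u"], of "g w"]
        by (intro mult_left_mono power_mono) (auto simp: P_def dist_norm)
      moreover have "2 * e * norm (w - y) \<le> 2 * e * norm (w - u) + 2 * e * norm (u - y)"
        using norm_triangle_ineq[of "w - u" "u - y"] \<open>0 < e\<close> by (simp flip: distrib_left)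
      ultimately show ?thesis
        unfolding \<phi>_def \<theta>_def by (simp add: inner_diff_right power2_norm_eq_inner)
    qed
    then have "- (2 * e) * norm h \<le> l \<bullet> g' u h - v \<bullet> h" for h
      using has_derivative_lower_bound[OF d\<theta>, of "\<rho> - dist u y" "2 * e" h] u by simp
    from this[of "v - adjoint (g' u) l"]
    have "(norm (v - adjoint (g' u) l))\<^sup>2 \<le> 2 * e * norm (v - adjoint (g' u) l)"
      unfolding power2_norm_eq_inner
      by (subst inner_diff_left) (simp add: adjoint_blinfun)
    then show ?thesis
      by (cases "v - adjoint (g' u) l = 0") (use \<open>0 < e\<close> in \<open>auto simp: power2_eq_square\<close>)
  qed
  moreover have "dist u y < e" "dist (P (g u)) (g y) < e" using u \<rho> d1[of u] by auto
  ultimately show ?thesis by blast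
qed

text \<open>Under the constraint qualification the approximating normals stay bounded, and a limit of
  them represents the given regular normal exactly.\<close>

lemma regular_normal_cone_vimage_multiplier:
  fixes g :: "'a::euclidean_space \<Rightarrow> 'b::euclidean_space" and g' :: "'a \<Rightarrow> 'a \<Rightarrow>\<^sub>L 'b"
  assumes g: "\<And>y. (g has_derivative g' y) (at y)" and C: "closed C" "convex C"
    and cont: "isCont g' y"
    and cq: "\<And>w. w \<in> normal_cone C (g y) \<Longrightarrow> adjoint (g' y) w = 0 \<Longrightarrow> w = 0"
    and v: "v \<in> regular_normal_cone (g -` C) y"
  obtains l where "l \<in> normal_cone C (g y)" "v = adjoint (g' y) l"
proof -
  obtain d c where "0 < d" "0 < c" and est: "\<And>u z w. dist u y < d \<Longrightarrow> dist z (g y) < d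
      \<Longrightarrow> w \<in> normal_cone C z \<Longrightarrow> norm w \<le> c * norm (adjoint (g' u) w)"
    using normal_cone_adjoint_estimate[OF C(1) cont cq] by metis
  define e where "e k = d / real (Suc k)" for k
  have e: "0 < e k" "e k \<le> d" for k
    using \<open>0 < d\<close> by (auto simp: e_def divide_simps)
  have elim: "e \<longlonglongrightarrow> 0"
    unfolding e_def using tendsto_mult_right_zero[OF LIMSEQ_Suc[OF lim_1_over_n], of d] by simp
  have "\<forall>k. \<exists>u z l. dist u y < e k \<and> dist z (g y) < e k \<and> l \<in> normal_cone C z \<and>
      norm (v - adjoint (g' u) l) \<le> 2 * e k"
    using regular_normal_cone_vimage_fuzzy[OF g C v e(1)] by blast
  then obtain u z l where u: "\<And>k. dist (u k) y < e k" and z: "\<And>k. dist (z k) (g y) < e k"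
    and l: "\<And>k. l k \<in> normal_cone C (z k)"
    and vl: "\<And>k. norm (v - adjoint (g' (u k)) (l k)) \<le> 2 * e k"
    by metis
  have "norm (l k) \<le> c * (norm v + 2 * d)" for k
  proof -
    have "norm (adjoint (g' (u k)) (l k)) \<le> norm v + 2 * d"
      using norm_triangle_ineq2[of "adjoint (g' (u k)) (l k)" v] vl[of k] e(2)[of k]
      by (simp add: norm_minus_commute)
    moreover have "norm (l k) \<le> c * norm (adjoint (g' (u k)) (l k))"
      using u[of k] z[of k] l[of k] e(2)[of k] by (intro est) auto
    ultimately show ?thesis
      using \<open>0 < c\<close> by (meson less_imp_le mult_left_mono order_trans)
  qed
  then have "\<forall>k. l k \<in> cball 0 (c * (norm v + 2 * d))" by simp
  then obtain l' r where r: "strict_mono (r :: nat \<Rightarrow> nat)" and lim: "(\<lambda>k. l (r k)) \<longlonglongrightarrow> l'"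
    using compact_cball unfolding compact_def comp_def by metis
  note sub = LIMSEQ_subseq_LIMSEQ[OF _ r, unfolded comp_def]
  have ulim: "u \<longlonglongrightarrow> y"
    by (rule metric_tendsto_imp_tendsto[OF elim]) (use u e(1) in \<open>auto intro!: always_eventually less_imp_le simp: abs_of_pos\<close>)
  have zlim: "z \<longlonglongrightarrow> g y"
    by (rule metric_tendsto_imp_tendsto[OF elim]) (use z e(1) in \<open>auto intro!: always_eventually less_imp_le simp: abs_of_pos\<close>)
  have "l' \<in> normal_cone C (g y)"
    by (rule normal_cone_closed_graph[OF C(1) lim sub[OF zlim]]) (rule l)
  moreover have "v - adjoint (g' y) l' = 0"
  proof (rule LIMSEQ_unique)
    show "(\<lambda>k. v - adjoint (g' (u (r k))) (l (r k))) \<longlonglongrightarrow> v - adjoint (g' y) l'"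
      by (intro tendsto_intros lim isCont_tendsto_compose[OF cont sub[OF ulim]])
    have "(\<lambda>k. 2 * e (r k)) \<longlonglongrightarrow> 0" by (rule tendsto_mult_right_zero[OF sub[OF elim]])
    then show "(\<lambda>k. v - adjoint (g' (u (r k))) (l (r k))) \<longlonglongrightarrow> 0"
      by (rule Lim_null_comparison[rotated]) (use vl in \<open>auto intro!: always_eventually\<close>)
  qed
  ultimately show ?thesis using that by simp
qed

section \<open>Local solvability near a point with surjective derivative\<close>

lemma C1_strictly_differentiable:
  fixes F :: "'a::real_normed_vector \<Rightarrow> 'b::real_normed_vector" and F' :: "'a \<Rightarrow> 'a \<Rightarrow>\<^sub>L 'b"
  assumes "open U" "p \<in> U" and F: "\<And>x. x \<in> U \<Longrightarrow> (F has_derivative F' x) (at x)"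
    and cont: "continuous_on U F'" and "0 < (e::real)"
  obtains d where "0 < d" "ball p d \<subseteq> U"
    "\<And>a b. a \<in> ball p d \<Longrightarrow> b \<in> ball p d \<Longrightarrow> norm (F a - F b - F' p (a - b)) \<le> e * norm (a - b)"
proof -
  obtain d0 where "0 < d0" and d0: "ball p d0 \<subseteq> U"
    using \<open>open U\<close> \<open>p \<in> U\<close> open_contains_ball by blast
  have "isCont F' p" using cont \<open>open U\<close> \<open>p \<in> U\<close> by (simp add: continuous_on_eq_continuous_at)
  then obtain d1 where "0 < d1" and d1: "\<And>x. dist x p < d1 \<Longrightarrow> dist (F' x) (F' p) < e"
    using \<open>0 < e\<close> unfolding continuous_at_eps_delta by metis
  define d where "d = min d0 d1"
  have d: "0 < d" "ball p d \<subseteq> U" using d0 \<open>0 < d0\<close> \<open>0 < d1\<close> by (auto simp: d_def)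
  have "norm (F a - F b - F' p (a - b)) \<le> e * norm (a - b)" if a: "a \<in> ball p d" and b: "b \<in> ball p d"
    for a b
  proof -
    have "norm (F a - F b - F' p (a - b)) \<le> norm (a - b) * e"
    proof (rule differentiable_bound_linearization[where S = "ball p d"])
      show "b + t *\<^sub>R (a - b) \<in> ball p d" if "t \<in> {0..1}" for t
        using convexD_alt[OF convex_ball b a, of t] that by (simp add: algebra_simps)
      show "(F has_derivative F' x) (at x within ball p d)" if "x \<in> ball p d" for x
        using F[of x] d(2) that by (blast intro: has_derivative_at_withinI)
      show "onorm (blinfun_apply (F' x) - blinfun_apply (F' p)) \<le> e" if "x \<in> ball p d" for x
      proof -
        have "blinfun_apply (F' x) - blinfun_apply (F' p) = blinfun_apply (F' x - F' p)"
          by (auto simp: fun_eq_iff blinfun.diff_left)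
        then show ?thesis
          using d1[of x] that by (simp add: norm_blinfun.rep_eq[symmetric] dist_norm d_def norm_minus_commute)
      qed
      show "p \<in> ball p d" using d(1) by simp
    qed
    then show ?thesis by (simp add: mult.commute)
  qed
  with d show ?thesis using that by blast
qed

text \<open>Every equation \<open>F x = w\<close> whose right-hand side is close to \<open>F u\<close>, for \<open>u\<close> near \<open>p\<close>, has a
  solution in \<open>U\<close> at a distance from \<open>u\<close> that is at most \<open>c\<close> times the residual.\<close>

definition solvable_near ::
    "('a::real_normed_vector \<Rightarrow> 'b::real_normed_vector) \<Rightarrow> 'a set \<Rightarrow> 'a \<Rightarrow> real \<Rightarrow> real \<Rightarrow> bool"
  where "solvable_near F U p d c \<longleftrightarrow> (\<forall>u w. dist u p < d \<longrightarrow> norm (w - F u) < d \<longrightarrow>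
    (\<exists>x\<in>U. F x = w \<and> norm (x - u) \<le> c * norm (w - F u)))"

lemma solvable_nearE:
  assumes "solvable_near F U p d c" "dist u p < d" "norm (w - F u) < d"
  obtains x where "x \<in> U" "F x = w" "norm (x - u) \<le> c * norm (w - F u)"
  using assms unfolding solvable_near_def by blast

text \<open>The Lyusternik-Graves theorem. With a linear right inverse \<open>R\<close> of the derivative at \<open>p\<close>, a
  solution of \<open>F (u + R r) = w\<close> is a fixed point of \<open>r \<mapsto> r + w - F (u + R r)\<close>, which is a
  contraction of factor \<open>1/2\<close> near the origin.\<close>

lemma surjective_derivative_solvable:
  fixes F :: "'a::euclidean_space \<Rightarrow> 'b::euclidean_space" and F' :: "'a \<Rightarrow> 'a \<Rightarrow>\<^sub>L 'b"
  assumes "open U" "p \<in> U" and F: "\<And>x. x \<in> U \<Longrightarrow> (F has_derivative F' x) (at x)"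
    and cont: "continuous_on U F'" and surj: "surj (blinfun_apply (F' p))"
  obtains d c where "0 < d" "0 < c" "solvable_near F U p d c"
proof -
  obtain R where "linear R" and R: "blinfun_apply (F' p) \<circ> R = id"
    using linear_surjective_right_inverse[OF bounded_linear.linear[OF blinfun.bounded_linear_right] surj]
    by blast
  then have "bounded_linear R" by (simp add: linear_conv_bounded_linear)
  then obtain K where "0 < K" and K: "\<And>r. norm (R r) \<le> norm r * K"
    using bounded_linear.pos_bounded by blast
  have FR: "F' p (R r) = r" for r using R by (metis comp_apply id_apply)
  obtain d where "0 < d" and dU: "ball p d \<subseteq> U"
    and d: "\<And>a b. a \<in> ball p d \<Longrightarrow> b \<in> ball p d
      \<Longrightarrow> norm (F a - F b - F' p (a - b)) \<le> 1 / (2 * K) * norm (a - b)"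
    using C1_strictly_differentiable[OF assms(1,2) F cont, of "1 / (2 * K)"] \<open>0 < K\<close> by auto
  define e where "e = min (d / 2) (d / (4 * K))"
  have "0 < e" using \<open>0 < d\<close> \<open>0 < K\<close> by (simp add: e_def)
  have "\<exists>x\<in>U. F x = w \<and> norm (x - u) \<le> 2 * K * norm (w - F u)"
    if u: "dist u p < e" and w: "norm (w - F u) < e" for u w
  proof -
    define S where "S = cball (0::'b) (2 * norm (w - F u))"
    define T where "T r = r + (w - F (u + R r))" for r
    have inball: "u + R r \<in> ball p d" if "r \<in> S" for r
    proof -
      have "norm r \<le> 2 * norm (w - F u)" using that by (simp add: S_def)
      also have "\<dots> < d / (2 * K)" using w by (simp add: e_def)
      finally have "norm r * K < d / 2" using \<open>0 < K\<close> by (simp add: field_simps)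
      then have "norm (R r) < d / 2" using K[of r] by linarith
      moreover have "dist p u < d / 2" using u by (simp add: e_def dist_commute)
      ultimately show ?thesis
        using norm_triangle_ineq4[of "p - u" "R r"] by (simp add: dist_norm diff_diff_eq)
    qed
    have contr: "dist (T r) (T s) \<le> 1/2 * dist r s" if "r \<in> S" "s \<in> S" for r s
    proof -
      have "T r - T s = - (F (u + R r) - F (u + R s) - F' p ((u + R r) - (u + R s)))"
        by (simp add: T_def blinfun.diff_right FR)
      then have "norm (T r - T s) \<le> 1 / (2 * K) * norm (R r - R s)"
        using d[OF inball[OF that(1)] inball[OF that(2)]] by (simp add: norm_minus_commute)
      also have "\<dots> \<le> 1 / (2 * K) * (norm (r - s) * K)"
        using K[of "r - s"] \<open>0 < K\<close> linear_diff[OF \<open>linear R\<close>]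
        by (intro mult_left_mono) auto
      also have "\<dots> = 1/2 * norm (r - s)" using \<open>0 < K\<close> by simp
      finally show ?thesis by (simp add: dist_norm)
    qed
    have "T 0 = w - F u" using linear_0[OF \<open>linear R\<close>] by (simp add: T_def)
    then have "T r \<in> S" if "r \<in> S" for r
      using contr[OF that, of 0] that norm_triangle_ineq2[of "T r" "T 0"]
      by (auto simp: S_def dist_norm)
    then have "\<exists>!r\<in>S. T r = r"
      using contr by (intro Banach_fix[of S "1/2"]) (auto simp: S_def compact_imp_complete)
    then obtain r where r: "r \<in> S" "T r = r" by blast
    have "norm (R r) \<le> 2 * K * norm (w - F u)"
    proof -
      have "norm r * K \<le> 2 * norm (w - F u) * K"
        using r(1) \<open>0 < K\<close> by (intro mult_right_mono) (auto simp: S_def)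
      then show ?thesis using K[of r] by (simp add: mult_ac)
    qed
    moreover have "F (u + R r) = w" using r(2) by (simp add: T_def)
    moreover have "u + R r \<in> U" using inball[OF r(1)] dU by blast
    ultimately show ?thesis by (intro bexI[of _ "u + R r"]) auto
  qed
  then show ?thesis using that[of e "2 * K"] \<open>0 < e\<close> \<open>0 < K\<close> by (simp add: solvable_near_def)
qed

section \<open>Normals under a reduction of the constraint set\<close>

text \<open>Where equations in the reducing map \<open>\<eta>\<close> can be solved locally, every vector that the
  derivative of \<open>\<eta>\<close> maps to a feasible direction \<open>x - \<eta> z\<close> of \<open>\<Xi>\<close> is tangent to \<open>\<Theta>\<close>: the
  segment from \<open>\<eta> z\<close> to \<open>x\<close> lifts to a sequence in \<open>\<Theta>\<close>.\<close>

lemma tangent_cone_reduction: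
  fixes \<eta> :: "'a::euclidean_space \<Rightarrow> 'b::euclidean_space" and D :: "'a \<Rightarrow> 'b"
  assumes sol: "solvable_near \<eta> V p d c"
    and red: "\<And>u. u \<in> V \<Longrightarrow> \<eta> u \<in> \<Xi> \<Longrightarrow> u \<in> \<Theta>"
    and z: "dist z p < d" and D: "(\<eta> has_derivative D) (at z)" and "0 < d"
    and "convex \<Xi>" "\<eta> z \<in> \<Xi>" "x \<in> \<Xi>" and w: "D w = x - \<eta> z"
  shows "w \<in> tangent_cone \<Theta> z"
proof -
  define t where "t k = 1 / real (Suc k)" for k
  have t: "0 < t k" "t k \<le> 1" for k by (auto simp: t_def)
  have tlim: "t \<longlonglongrightarrow> 0" unfolding t_def by (rule LIMSEQ_Suc[OF lim_1_over_n])
  define e where "e k = (\<eta> z + t k *\<^sub>R (x - \<eta> z)) - \<eta> (z + t k *\<^sub>R w)" for k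
  have "(\<lambda>k. (x - \<eta> z) - (\<eta> (z + t k *\<^sub>R w) - \<eta> z) /\<^sub>R t k) \<longlonglongrightarrow> (x - \<eta> z) - D w"
    by (intro tendsto_intros has_derivative_sequentially[OF D] tlim t)
  moreover have "(x - \<eta> z) - (\<eta> (z + t k *\<^sub>R w) - \<eta> z) /\<^sub>R t k = e k /\<^sub>R t k" for k
    using t(1)[of k] by (simp add: e_def algebra_simps)
  ultimately have qlim: "(\<lambda>k. e k /\<^sub>R t k) \<longlonglongrightarrow> 0" using w by simp
  from tendsto_scaleR[OF tlim this] have elim: "e \<longlonglongrightarrow> 0" using t(1) by (simp add: less_imp_neq[symmetric])
  have zlim: "(\<lambda>k. z + t k *\<^sub>R w) \<longlonglongrightarrow> z"
    using tendsto_add[OF tendsto_const tendsto_scaleR[OF tlim tendsto_const]] by simp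
  have "\<forall>\<^sub>F k in sequentially. dist (e k) 0 < d" using elim \<open>0 < d\<close> by (simp add: tendsto_iff)
  moreover have "\<forall>\<^sub>F k in sequentially. dist (z + t k *\<^sub>R w) z < d - dist z p"
    using zlim z by (simp add: tendsto_iff)
  ultimately have "\<forall>\<^sub>F k in sequentially. \<exists>u\<in>V. \<eta> u = \<eta> z + t k *\<^sub>R (x - \<eta> z) \<and>
      norm (u - (z + t k *\<^sub>R w)) \<le> c * norm (e k)"
  proof eventually_elim
    case (elim k)
    show ?case unfolding e_def
    proof (rule sol[unfolded solvable_near_def, rule_format])
      show "dist (z + t k *\<^sub>R w) p < d" using elim(2) dist_triangle[of "z + t k *\<^sub>R w" p z] by linarith
      show "norm (\<eta> z + t k *\<^sub>R (x - \<eta> z) - \<eta> (z + t k *\<^sub>R w)) < d" using elim(1) by (simp add: e_def)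
    qed
  qed
  then obtain N where "\<forall>k\<ge>N. \<exists>u\<in>V. \<eta> u = \<eta> z + t k *\<^sub>R (x - \<eta> z) \<and>
      norm (u - (z + t k *\<^sub>R w)) \<le> c * norm (e k)"
    by (auto simp: eventually_sequentially)
  then have "\<forall>k. \<exists>u\<in>V. \<eta> u = \<eta> z + t (k + N) *\<^sub>R (x - \<eta> z) \<and>
      norm (u - (z + t (k + N) *\<^sub>R w)) \<le> c * norm (e (k + N))"
    by simp
  then obtain u where uV: "\<And>k. u k \<in> V" and u\<eta>: "\<And>k. \<eta> (u k) = \<eta> z + t (k + N) *\<^sub>R (x - \<eta> z)"
    and u: "\<And>k. norm (u k - (z + t (k + N) *\<^sub>R w)) \<le> c * norm (e (k + N))"
    by metis
  define w' where "w' k = (u k - z) /\<^sub>R t (k + N)" for k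
  show ?thesis
  proof (rule tangent_coneI)
    show "0 < t (k + N)" for k by (rule t)
    show "(\<lambda>k. t (k + N)) \<longlonglongrightarrow> 0" by (rule LIMSEQ_ignore_initial_segment[OF tlim])
    have "(\<lambda>k. w' k - w) \<longlonglongrightarrow> 0"
    proof (rule Lim_null_comparison)
      show "(\<lambda>k. c * norm (e (k + N) /\<^sub>R t (k + N))) \<longlonglongrightarrow> 0"
        using tendsto_mult_right_zero[OF tendsto_norm_zero[OF LIMSEQ_ignore_initial_segment[OF qlim]]] .
      have "norm (w' k - w) \<le> c * norm (e (k + N) /\<^sub>R t (k + N))" for k
      proof -
        have "w' k - w = (u k - (z + t (k + N) *\<^sub>R w)) /\<^sub>R t (k + N)"
          using t(1)[of "k + N"] by (simp add: w'_def algebra_simps)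
        then show ?thesis using u[of k] t(1)[of "k + N"] by (simp add: divide_simps mult_ac)
      qed
      then show "\<forall>\<^sub>F k in sequentially. norm (w' k - w) \<le> c * norm (e (k + N) /\<^sub>R t (k + N))"
        by simp
    qed
    then show "w' \<longlonglongrightarrow> w" by (rule LIM_zero_cancel)
    show "z + t (k + N) *\<^sub>R w' k \<in> \<Theta>" for k
    proof -
      have "(1 - t (k + N)) *\<^sub>R \<eta> z + t (k + N) *\<^sub>R x \<in> \<Xi>"
        using assms(6-8) t[of "k + N"] by (intro convexD) (auto simp: less_imp_le)
      then have "\<eta> (u k) \<in> \<Xi>" by (simp add: u\<eta> algebra_simps)
      then have "u k \<in> \<Theta>" by (rule red[OF uV])
      then show ?thesis using t(1)[of "k + N"] by (simp add: w'_def)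
    qed
  qed
qed

text \<open>A vector that annihilates the kernel of a linear map lies in the range of its adjoint.\<close>

lemma orthogonal_kernel_imp_adjoint:
  fixes D :: "'a::euclidean_space \<Rightarrow>\<^sub>L 'b::euclidean_space"
  assumes "\<And>w. D w = 0 \<Longrightarrow> v \<bullet> w \<le> 0"
  obtains n where "v = adjoint D n"
proof -
  have lin: "linear (adjoint D)"
    by (intro adjoint_linear bounded_linear.linear[OF blinfun.bounded_linear_right])
  obtain a b where a: "a \<in> span (range (adjoint D))"
    and b: "\<And>w. w \<in> span (range (adjoint D)) \<Longrightarrow> orthogonal b w" and v: "v = a + b"
    using orthogonal_subspace_decomp_exists by blast
  have range: "span (range (adjoint D)) = range (adjoint D)"
    by (intro span_eq_iff[THEN iffD2] linear_subspace_image[OF lin] subspace_UNIV)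
  have "n \<bullet> D b = 0" for n
    using b[of "adjoint D n"] by (simp add: range orthogonal_def inner_commute adjoint_blinfun)
  then have "D b = 0" by (metis inner_eq_zero_iff)
  then have "v \<bullet> b \<le> 0" by (rule assms)
  moreover have "a \<bullet> b = 0" using b[OF a] by (simp add: orthogonal_def inner_commute)
  ultimately have "b \<bullet> b \<le> 0" by (simp add: v inner_add_left)
  then have "b = 0" using inner_gt_zero_iff[of b] by linarith
  then show ?thesis using a v that unfolding range by auto
qed

text \<open>Normals to \<open>\<Theta>\<close> come from normals to \<open>\<Xi>\<close>, and conversely. Taking \<open>x = \<eta> z\<close> in the previous
  lemma shows that the kernel of the derivative is tangent to \<open>\<Theta>\<close>, so normals annihilate it.\<close>

lemma normal_cone_reductionE:
  fixes \<eta> :: "'a::euclidean_space \<Rightarrow> 'b::euclidean_space" and D :: "'a \<Rightarrow>\<^sub>L 'b"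
  assumes sol: "solvable_near \<eta> V p d c"
    and red: "\<And>u. u \<in> V \<Longrightarrow> \<eta> u \<in> \<Xi> \<Longrightarrow> u \<in> \<Theta>"
    and z: "dist z p < d" and D: "(\<eta> has_derivative D) (at z)" and "0 < d"
    and "convex \<Xi>" "\<eta> z \<in> \<Xi>" and surj: "surj (blinfun_apply D)" and v: "v \<in> normal_cone \<Theta> z"
  obtains n where "n \<in> normal_cone \<Xi> (\<eta> z)" "v = adjoint D n"
proof -
  have le: "v \<bullet> w \<le> 0" if "x \<in> \<Xi>" "D w = x - \<eta> z" for x w
    using tangent_cone_reduction[OF sol red z D \<open>0 < d\<close> assms(6,7) that]
      normal_cone_tangent_cone[OF v] by blast
  obtain n where n: "v = adjoint D n"
    using orthogonal_kernel_imp_adjoint le[OF assms(7)] by (metis diff_self)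
  have "n \<bullet> (x - \<eta> z) \<le> 0" if "x \<in> \<Xi>" for x
  proof -
    obtain w where "D w = x - \<eta> z" using surj by (metis surjD)
    then show ?thesis using le[OF that, of w] by (simp add: n adjoint_blinfun)
  qed
  then show ?thesis using that[OF _ n] assms(7) by (simp add: normal_cone_iff)
qed

lemma adjoint_reduction_in_normal_cone:
  fixes \<eta> :: "'a::euclidean_space \<Rightarrow> 'b::euclidean_space" and D :: "'a \<Rightarrow>\<^sub>L 'b"
  assumes "convex \<Theta>" "open V" "z \<in> V" and red: "\<And>u. u \<in> V \<Longrightarrow> u \<in> \<Theta> \<longleftrightarrow> \<eta> u \<in> \<Xi>"
    and D: "(\<eta> has_derivative D) (at z)" and n: "n \<in> normal_cone \<Xi> (\<eta> z)"
  shows "adjoint D n \<in> normal_cone \<Theta> z"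
proof -
  have z: "z \<in> \<Theta>" using n red[OF \<open>z \<in> V\<close>] by (simp add: normal_cone_iff)
  have "adjoint D n \<bullet> (u - z) \<le> 0" if "u \<in> \<Theta>" for u
  proof -
    define t where "t k = 1 / real (Suc k)" for k
    have t: "0 < t k" "t k \<le> 1" for k by (auto simp: t_def)
    have tlim: "t \<longlonglongrightarrow> 0" unfolding t_def by (rule LIMSEQ_Suc[OF lim_1_over_n])
    have "(\<lambda>k. z + t k *\<^sub>R (u - z)) \<longlonglongrightarrow> z"
      using tendsto_add[OF tendsto_const tendsto_scaleR[OF tlim tendsto_const]] by simp
    then have "\<forall>\<^sub>F k in sequentially. z + t k *\<^sub>R (u - z) \<in> V"
      by (rule topological_tendstoD[OF _ assms(2,3)])
    then have "\<forall>\<^sub>F k in sequentially. n \<bullet> ((\<eta> (z + t k *\<^sub>R (u - z)) - \<eta> z) /\<^sub>R t k) \<le> 0"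
    proof eventually_elim
      case (elim k)
      have "(1 - t k) *\<^sub>R z + t k *\<^sub>R u \<in> \<Theta>"
        using \<open>convex \<Theta>\<close> z that t[of k] by (intro convexD) (auto simp: less_imp_le)
      then have "z + t k *\<^sub>R (u - z) \<in> \<Theta>" by (simp add: algebra_simps)
      then have "n \<bullet> (\<eta> (z + t k *\<^sub>R (u - z)) - \<eta> z) \<le> 0"
        using n red[OF elim] by (simp add: normal_cone_iff)
      then show ?case using t(1)[of k] by (simp add: mult_nonneg_nonpos)
    qed
    moreover have "(\<lambda>k. n \<bullet> ((\<eta> (z + t k *\<^sub>R (u - z)) - \<eta> z) /\<^sub>R t k)) \<longlonglongrightarrow> n \<bullet> D (u - z)"
      by (intro tendsto_intros has_derivative_sequentially[OF D] tlim t)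
    ultimately show ?thesis
      unfolding adjoint_blinfun by (intro tendsto_upperbound) auto
  qed
  then show ?thesis using z by (simp add: normal_cone_iff)
qed

lemma tangent_cone_image:
  fixes \<eta> :: "'a::real_normed_vector \<Rightarrow> 'b::real_normed_vector"
  assumes "open V" "z \<in> V" and red: "\<And>u. u \<in> V \<Longrightarrow> u \<in> \<Theta> \<Longrightarrow> \<eta> u \<in> \<Xi>"
    and D: "(\<eta> has_derivative D) (at z)" and w: "w \<in> tangent_cone \<Theta> z"
  shows "D w \<in> tangent_cone \<Xi> (\<eta> z)"
proof -
  obtain t u where t: "\<And>k::nat. 0 < t k" "t \<longlonglongrightarrow> 0" and u: "u \<longlonglongrightarrow> w" "\<And>k. z + t k *\<^sub>R u k \<in> \<Theta>"
    using tangent_coneE[OF w] by metis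
  have "(\<lambda>k. z + t k *\<^sub>R u k) \<longlonglongrightarrow> z"
    using tendsto_add[OF tendsto_const tendsto_scaleR[OF t(2) u(1)]] by simp
  then have "\<forall>\<^sub>F k in sequentially. z + t k *\<^sub>R u k \<in> V"
    by (rule topological_tendstoD[OF _ assms(1,2)])
  then obtain N where N: "\<And>k. N \<le> k \<Longrightarrow> z + t k *\<^sub>R u k \<in> V"
    unfolding eventually_sequentially by blast
  show ?thesis
  proof (rule tangent_coneI)
    show "0 < t (k + N)" for k by (rule t)
    show "(\<lambda>k. t (k + N)) \<longlonglongrightarrow> 0" by (rule LIMSEQ_ignore_initial_segment[OF t(2)])
    show "(\<lambda>k. (\<eta> (z + t (k + N) *\<^sub>R u (k + N)) - \<eta> z) /\<^sub>R t (k + N)) \<longlonglongrightarrow> D w"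
      by (intro has_derivative_sequentially[OF D] t LIMSEQ_ignore_initial_segment[OF t(2)]
          LIMSEQ_ignore_initial_segment[OF u(1)])
    show "\<eta> z + t (k + N) *\<^sub>R ((\<eta> (z + t (k + N) *\<^sub>R u (k + N)) - \<eta> z) /\<^sub>R t (k + N)) \<in> \<Xi>" for k
      using red[OF N u(2)] t(1)[of "k + N"] by simp
  qed
qed

text \<open>Pointedness makes the kernel of the reducing map large: it contains the whole lineality
  space of the tangent cone.\<close>

lemma pointed_reduction_kernel:
  fixes \<eta> :: "'a::euclidean_space \<Rightarrow> 'b::euclidean_space"
  assumes "convex \<Theta>" "z \<in> \<Theta>" "open V" "z \<in> V"
    and red: "\<And>u. u \<in> V \<Longrightarrow> u \<in> \<Theta> \<Longrightarrow> \<eta> u \<in> \<Xi>"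
    and D: "(\<eta> has_derivative D) (at z)" and pointed: "pointed (tangent_cone \<Xi> (\<eta> z))"
    and w: "w \<in> lin (tangent_cone \<Theta> z)"
  shows "D w = 0"
proof -
  note T = convex_tangent_cone[OF assms(1,2)] cone_tangent_cone[OF assms(1,2)]
    zero_in_tangent_cone[OF assms(1,2)]
  note im = tangent_cone_image[OF assms(3,4) red D]
  have "D w \<in> tangent_cone \<Xi> (\<eta> z)" using im lin_subset[OF T] w by blast
  moreover have "D (- w) \<in> tangent_cone \<Xi> (\<eta> z)"
    using im lin_subset[OF T] subspace_neg[OF subspace_lin[OF T] w] by blast
  then have "D w \<in> uminus ` tangent_cone \<Xi> (\<eta> z)"
    using linear_neg[OF has_derivative_linear[OF D], of w] by (metis image_eqI minus_minus)
  ultimately show ?thesis using pointed unfolding pointed_def by blast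
qed

section \<open>First-order variations of normals\<close>

text \<open>The projection derivation condition says that the graph of the normal cone map is, to first
  order at \<open>(z, b)\<close>, the graph of the normal cone map of the critical cone. This holds in both
  directions, because \<open>v \<in> normal_cone \<Theta> u\<close> means that \<open>u\<close> is the projection of \<open>u + v\<close>.\<close>

lemma normal_cone_variation_limit:
  fixes \<Theta> :: "'a::euclidean_space set"
  assumes \<Theta>: "closed \<Theta>" "convex \<Theta>" and pdc: "projection_derivation_condition \<Theta> z"
    and b: "b \<in> normal_cone \<Theta> z" and t: "\<And>k. 0 < t k" "t \<longlonglongrightarrow> (0::real)"
    and w: "w \<longlonglongrightarrow> w'" and m: "m \<longlonglongrightarrow> m'"
    and n: "\<And>k. b + t k *\<^sub>R m k \<in> normal_cone \<Theta> (z + t k *\<^sub>R w k)"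
  shows "m' \<in> normal_cone (critical_cone \<Theta> z b) w'"
proof -
  let ?K = "critical_cone \<Theta> z b" and ?P = "closest_point \<Theta>"
  have z: "z \<in> \<Theta>" using b by (simp add: normal_cone_iff)
  have Pz: "?P (z + b) = z" using closest_point_eq_iff_normal_cone[OF \<Theta> z] b by blast
  have "has_dir_derivative ?P (z + b) (w' + m') (closest_point ?K (w' + m'))"
    using pdc b by (simp add: projection_derivation_condition_def)
  then have "(\<lambda>k. (?P (z + b + t k *\<^sub>R (w k + m k)) - ?P (z + b)) /\<^sub>R t k)
      \<longlonglongrightarrow> closest_point ?K (w' + m')"
    by (rule has_dir_derivative_sequentially[where C = 1])
      (use closest_point_lipschitz[OF \<Theta>(2,1)] z t tendsto_add[OF w m] in auto)
  moreover have "?P (z + b + t k *\<^sub>R (w k + m k)) = z + t k *\<^sub>R w k" for k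
  proof -
    have "z + t k *\<^sub>R w k \<in> \<Theta>" using n[of k] by (simp add: normal_cone_iff)
    then have "?P (z + t k *\<^sub>R w k + (b + t k *\<^sub>R m k)) = z + t k *\<^sub>R w k"
      using closest_point_eq_iff_normal_cone[OF \<Theta>] n[of k] by blast
    then show ?thesis by (simp add: algebra_simps)
  qed
  ultimately have "w \<longlonglongrightarrow> closest_point ?K (w' + m')" using t(1) by (simp add: Pz less_imp_neq[symmetric])
  then have eq: "closest_point ?K (w' + m') = w'" using w LIMSEQ_unique by blast
  note K = closed_critical_cone[OF \<Theta>(2) b] convex_critical_cone[OF \<Theta>(2) b]
  have "w' \<in> ?K"
    using closest_point_in_set[OF K(1), of "w' + m'"] zero_in_critical_cone[OF \<Theta>(2) b] eq by auto
  then show ?thesis using closest_point_eq_iff_normal_cone[OF K] eq by blast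
qed

lemma normal_cone_variation_exists:
  fixes \<Theta> :: "'a::euclidean_space set"
  assumes \<Theta>: "closed \<Theta>" "convex \<Theta>" and pdc: "projection_derivation_condition \<Theta> z"
    and b: "b \<in> normal_cone \<Theta> z" and t: "\<And>k. 0 < t k" "t \<longlonglongrightarrow> (0::real)"
    and m': "m' \<in> normal_cone (critical_cone \<Theta> z b) w'"
  obtains w m where "w \<longlonglongrightarrow> w'" "m \<longlonglongrightarrow> m'" "\<And>k. b + t k *\<^sub>R m k \<in> normal_cone \<Theta> (z + t k *\<^sub>R w k)"
proof -
  let ?K = "critical_cone \<Theta> z b" and ?P = "closest_point \<Theta>"
  have z: "z \<in> \<Theta>" using b by (simp add: normal_cone_iff)
  have Pz: "?P (z + b) = z" using closest_point_eq_iff_normal_cone[OF \<Theta> z] b by blast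
  have "w' \<in> ?K" using m' by (simp add: normal_cone_iff)
  then have PK: "closest_point ?K (w' + m') = w'"
    using closest_point_eq_iff_normal_cone[OF closed_critical_cone[OF \<Theta>(2) b]
        convex_critical_cone[OF \<Theta>(2) b]] m' by blast
  define u where "u k = z + b + t k *\<^sub>R (w' + m')" for k
  define w where "w k = (?P (u k) - z) /\<^sub>R t k" for k
  define m where "m k = w' + m' - w k" for k
  have "has_dir_derivative ?P (z + b) (w' + m') (closest_point ?K (w' + m'))"
    using pdc b by (simp add: projection_derivation_condition_def)
  then have "(\<lambda>k. (?P (z + b + t k *\<^sub>R (w' + m')) - ?P (z + b)) /\<^sub>R t k) \<longlonglongrightarrow> closest_point ?K (w' + m')"
    by (rule has_dir_derivative_sequentially[where C = 1])
      (use closest_point_lipschitz[OF \<Theta>(2,1)] z t in auto)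
  then have w: "w \<longlonglongrightarrow> w'" by (simp add: w_def[abs_def] u_def PK Pz)
  have "m \<longlonglongrightarrow> w' + m' - w'" unfolding m_def[abs_def] by (intro tendsto_intros w)
  then have m: "m \<longlonglongrightarrow> m'" by simp
  have "b + t k *\<^sub>R m k \<in> normal_cone \<Theta> (z + t k *\<^sub>R w k)" for k
  proof -
    have "z + t k *\<^sub>R w k = ?P (u k)" using t(1)[of k] by (simp add: w_def)
    moreover have "b + t k *\<^sub>R m k = u k - ?P (u k)"
      using t(1)[of k] by (simp add: m_def w_def u_def algebra_simps)
    ultimately show ?thesis using closest_point_normal_cone[OF \<Theta>, of "u k"] z by auto
  qed
  with w m show ?thesis using that by blast
qed

section \<open>Lifting variations of normals to the variables of the constraint system\<close>

lemma nondegenerate_adjoint_inj: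
  fixes A :: "'a::euclidean_space \<Rightarrow>\<^sub>L 'b::euclidean_space"
  assumes nd: "{A u + w | u w. w \<in> L} = UNIV"
    and orth: "\<And>w. w \<in> L \<Longrightarrow> v \<bullet> w = 0" and "adjoint A v = 0"
  shows "v = 0"
proof -
  obtain u w where "v = A u + w" "w \<in> L" using nd by blast
  then have "v \<bullet> v = adjoint A v \<bullet> u + v \<bullet> w" by (simp add: adjoint_blinfun inner_add_right)
  then show ?thesis using assms(3) orth[OF \<open>w \<in> L\<close>] by simp
qed

lemma surj_adjoint_estimate:
  fixes D :: "'a::euclidean_space \<Rightarrow>\<^sub>L 'b::euclidean_space"
  assumes "\<And>n. norm n \<le> c * norm (adjoint D n)"
  shows "surj (blinfun_apply D)"
proof -
  have lin: "linear (blinfun_apply D)"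
    by (rule bounded_linear.linear[OF blinfun.bounded_linear_right])
  have "n = 0" if "adjoint D n = 0" for n using assms[of n] that by simp
  then have "inj (adjoint D)"
    using linear_injective_0[OF adjoint_linear[OF lin]] by blast
  then show ?thesis using inj_adjoint_iff_surj[OF lin] by blast
qed

text \<open>A first-order variation \<open>(g' y v', m')\<close> of a normal pair \<open>(g y, b)\<close> of \<open>\<Theta>\<close> is realized by
  normals at points of the form \<open>g (y + t v)\<close>. The projection derivation condition by itself
  realizes it by normals \<open>b + t m\<close> at points \<open>z\<close> that need not be values of \<open>g\<close>. Nondegeneracy
  and the inclusion of the lineality space in the kernel of the derivative of \<open>\<eta>\<close> make
  \<open>\<eta> \<circ> g\<close> a submersion, so some point \<open>u\<close> close to \<open>y + t v'\<close> satisfies \<open>\<eta> (g u) = \<eta> z\<close>.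
  Then \<open>\<Xi>\<close> has the same normals at both, and pulling back to \<open>g u\<close> the normal to \<open>\<Xi>\<close> that
  represents \<open>b + t m\<close> at \<open>z\<close> changes it by \<open>o(t)\<close> only.\<close>

lemma normal_variation_lift_reduction:
  fixes g :: "'a::euclidean_space \<Rightarrow> 'b::euclidean_space" and g' :: "'a \<Rightarrow> 'a \<Rightarrow>\<^sub>L 'b"
    and \<eta> :: "'b \<Rightarrow> 'c::euclidean_space" and \<eta>' :: "'b \<Rightarrow> 'b \<Rightarrow>\<^sub>L 'c"
  assumes g: "\<And>u. (g has_derivative g' u) (at u)" and g'cont: "continuous_on UNIV g'"
    and \<Theta>: "closed \<Theta>" "convex \<Theta>" and pdc: "projection_derivation_condition \<Theta> (g y)"
    and b: "b \<in> normal_cone \<Theta> (g y)"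
    and nd: "{g' y u + w | u w. w \<in> lin (tangent_cone \<Theta> (g y))} = UNIV"
    and V: "open V" "g y \<in> V" and \<eta>: "\<And>z. z \<in> V \<Longrightarrow> (\<eta> has_derivative \<eta>' z) (at z)"
    and \<eta>'cont: "continuous_on V \<eta>'" and \<eta>'': "(\<eta>' has_derivative \<eta>'') (at (g y))"
    and red: "\<And>z. z \<in> V \<Longrightarrow> z \<in> \<Theta> \<longleftrightarrow> \<eta> z \<in> \<Xi>" and "convex \<Xi>"
    and pointed: "pointed (tangent_cone \<Xi> (\<eta> (g y)))" and surj: "surj (blinfun_apply (\<eta>' (g y)))"
    and m': "m' \<in> normal_cone (critical_cone \<Theta> (g y) b) (g' y v')"
    and t: "\<And>k. 0 < t k" "t \<longlonglongrightarrow> (0::real)"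
  obtains v m where "v \<longlonglongrightarrow> v'" "m \<longlonglongrightarrow> m'"
    "\<forall>\<^sub>F k in sequentially. b + t k *\<^sub>R m k \<in> normal_cone \<Theta> (g (y + t k *\<^sub>R v k))"
proof -
  let ?z = "g y"
  have z: "?z \<in> \<Theta>" using b by (simp add: normal_cone_iff)
  have gcont: "isCont g u" for u by (rule has_derivative_continuous[OF g])
  have shrink: "(\<lambda>k. p + t k *\<^sub>R x k) \<longlonglongrightarrow> p" if "x \<longlonglongrightarrow> x'"
    for p x' :: "'d::real_normed_vector" and x
    using tendsto_add[OF tendsto_const tendsto_scaleR[OF t(2) that]] by simp
  obtain w m where w: "w \<longlonglongrightarrow> g' y v'" and m: "m \<longlonglongrightarrow> m'"
    and n: "\<And>k. b + t k *\<^sub>R m k \<in> normal_cone \<Theta> (?z + t k *\<^sub>R w k)"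
    using normal_cone_variation_exists[OF \<Theta> pdc b t m'] by blast
  define z where "z k = ?z + t k *\<^sub>R w k" for k
  have zlim: "z \<longlonglongrightarrow> ?z" unfolding z_def[abs_def] by (rule shrink[OF w])

  \<comment> \<open>Normals to \<open>\<Xi>\<close> that represent the given ones.\<close>
  have \<eta>'isCont: "isCont \<eta>' ?z" by (rule has_derivative_continuous[OF \<eta>''])
  have "x = 0" if "x \<in> normal_cone {\<eta> ?z} (\<eta> ?z)" "adjoint (\<eta>' ?z) x = 0" for x
    by (rule nondegenerate_adjoint_inj[where L = "{0}" and A = "\<eta>' ?z"]) (use surj that(2) in \<open>auto simp: image_def\<close>)
  then obtain d1 c1 where "0 < d1" "0 < c1" and est: "\<And>u p x. dist u ?z < d1 \<Longrightarrow>
      dist p (\<eta> ?z) < d1 \<Longrightarrow> x \<in> normal_cone {\<eta> ?z} p \<Longrightarrow> norm x \<le> c1 * norm (adjoint (\<eta>' u) x)"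
    using normal_cone_adjoint_estimate[where C = "{\<eta> ?z}" and G = \<eta>' and z = "\<eta> ?z",
        OF closed_singleton \<eta>'isCont] by blast
  have est: "norm x \<le> c1 * norm (adjoint (\<eta>' u) x)" if "dist u ?z < d1" for u x
    using est[OF that, of "\<eta> ?z" x] \<open>0 < d1\<close> by (simp add: normal_cone_iff)
  obtain d2 c2 where "0 < d2" and sol\<eta>: "solvable_near \<eta> V ?z d2 c2"
    using surjective_derivative_solvable[OF V \<eta> \<eta>'cont surj] by blast
  have red': "\<And>u. u \<in> V \<Longrightarrow> \<eta> u \<in> \<Xi> \<Longrightarrow> u \<in> \<Theta>" using red by blast
  have "\<forall>\<^sub>F k in sequentially. z k \<in> V \<and> dist (z k) ?z < min d1 d2"
    using topological_tendstoD[OF zlim V] zlim \<open>0 < d1\<close> \<open>0 < d2\<close>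
    by (intro eventually_conj) (auto simp: tendsto_iff intro: eventually_conj)
  then have "\<forall>\<^sub>F k in sequentially. \<exists>q. q \<in> normal_cone \<Xi> (\<eta> (z k)) \<and>
      b + t k *\<^sub>R m k = adjoint (\<eta>' (z k)) q \<and> norm q \<le> c1 * norm (b + t k *\<^sub>R m k)"
  proof eventually_elim
    case (elim k)
    have nk: "b + t k *\<^sub>R m k \<in> normal_cone \<Theta> (z k)" using n by (simp add: z_def)
    then have "\<eta> (z k) \<in> \<Xi>" using red elim by (auto simp: normal_cone_iff)
    moreover have "surj (blinfun_apply (\<eta>' (z k)))"
      using est elim by (intro surj_adjoint_estimate) auto
    ultimately obtain q where "q \<in> normal_cone \<Xi> (\<eta> (z k))" "b + t k *\<^sub>R m k = adjoint (\<eta>' (z k)) q"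
      using normal_cone_reductionE[OF sol\<eta> red' _ \<eta> \<open>0 < d2\<close> \<open>convex \<Xi>\<close> _ _ nk] elim by auto
    then show ?case using est[of "z k" q] elim by auto
  qed
  then obtain q where q: "\<forall>\<^sub>F k in sequentially. q k \<in> normal_cone \<Xi> (\<eta> (z k)) \<and>
      b + t k *\<^sub>R m k = adjoint (\<eta>' (z k)) (q k) \<and> norm (q k) \<le> c1 * norm (b + t k *\<^sub>R m k)"
    unfolding eventually_ex by blast

  \<comment> \<open>Solving \<open>\<eta> (g u) = \<eta> (z k)\<close>.\<close>
  define h where "h u = \<eta> (g u)" for u
  define h' where "h' u = \<eta>' (g u) o\<^sub>L g' u" for u
  define U where "U = g -` V"
  have "open U" "y \<in> U"
    unfolding U_def using V gcont by (auto intro: continuous_open_vimage)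
  have h: "(h has_derivative h' u) (at u)" if "u \<in> U" for u
    using diff_chain_at[OF g \<eta>, of u] that
    by (simp add: h_def[abs_def] h'_def U_def comp_def blinfun_compose.rep_eq)
  have h'cont: "continuous_on U h'"
    unfolding h'_def
  proof (intro bounded_bilinear.continuous_on[OF bounded_bilinear_blinfun_compose])
    show "continuous_on U (\<lambda>u. \<eta>' (g u))"
      by (rule continuous_on_compose2[OF \<eta>'cont]) (use gcont in \<open>auto simp: U_def continuous_at_imp_continuous_on\<close>)
    show "continuous_on U g'" using g'cont continuous_on_subset by blast
  qed
  have h'surj: "surj (blinfun_apply (h' y))"
  proof (rule surjI)
    fix r
    obtain p where p: "r = \<eta>' ?z p" using surj by (rule surjE)
    obtain u x where "p = g' y u + x" "x \<in> lin (tangent_cone \<Theta> ?z)" using nd by blast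
    moreover from this(2) have "\<eta>' ?z x = 0"
      by (rule pointed_reduction_kernel[OF \<Theta>(2) z V _ \<eta>[OF V(2)] pointed, rotated]) (use red in blast)
    ultimately have "h' y u = r" by (simp add: p h'_def blinfun.add_right blinfun_compose.rep_eq)
    then show "h' y (SOME u. h' y u = r) = r" by (rule someI)
  qed
  obtain d3 c3 where "0 < d3" "0 < c3" and solh: "solvable_near h U y d3 c3"
    using surjective_derivative_solvable[OF \<open>open U\<close> \<open>y \<in> U\<close> h h'cont h'surj] by blast
  define e where "e k = \<eta> (z k) - h (y + t k *\<^sub>R v')" for k
  have qlim: "(\<lambda>k. e k /\<^sub>R t k) \<longlonglongrightarrow> 0"
  proof -
    have "(\<lambda>k. (\<eta> (?z + t k *\<^sub>R w k) - \<eta> ?z) /\<^sub>R t k) \<longlonglongrightarrow> \<eta>' ?z (g' y v')"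
      by (rule has_derivative_sequentially[OF \<eta>[OF V(2)] t w])
    moreover have "(\<lambda>k. (h (y + t k *\<^sub>R v') - h y) /\<^sub>R t k) \<longlonglongrightarrow> h' y v'"
      by (rule has_derivative_sequentially[OF h[OF \<open>y \<in> U\<close>] t tendsto_const])
    ultimately have "(\<lambda>k. (\<eta> (?z + t k *\<^sub>R w k) - \<eta> ?z) /\<^sub>R t k - (h (y + t k *\<^sub>R v') - h y) /\<^sub>R t k)
        \<longlonglongrightarrow> \<eta>' ?z (g' y v') - h' y v'"
      by (rule tendsto_diff)
    then show ?thesis
      by (simp add: e_def z_def h_def h'_def blinfun_compose.rep_eq flip: scaleR_diff_right)
  qed
  from tendsto_scaleR[OF t(2) this] have elim: "e \<longlonglongrightarrow> 0"
    using t(1) by (simp add: less_imp_neq[symmetric])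
  have ylim: "(\<lambda>k. y + t k *\<^sub>R v') \<longlonglongrightarrow> y" by (rule shrink[OF tendsto_const])
  have "\<forall>\<^sub>F k in sequentially. dist (y + t k *\<^sub>R v') y < d3 \<and> dist (e k) 0 < d3"
    using ylim elim \<open>0 < d3\<close> by (intro eventually_conj) (auto simp: tendsto_iff)
  then have "\<forall>\<^sub>F k in sequentially. \<exists>u. u \<in> U \<and> h u = \<eta> (z k) \<and>
      norm (u - (y + t k *\<^sub>R v')) \<le> c3 * norm (e k)"
  proof eventually_elim
    case (elim k)
    then show ?case
      using solvable_nearE[OF solh, of "y + t k *\<^sub>R v'" "\<eta> (z k)"] by (auto simp: e_def)
  qed
  then obtain u where u: "\<forall>\<^sub>F k in sequentially. u k \<in> U \<and> h (u k) = \<eta> (z k) \<and>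
      norm (u k - (y + t k *\<^sub>R v')) \<le> c3 * norm (e k)"
    unfolding eventually_ex by blast
  define v where "v k = (u k - y) /\<^sub>R t k" for k
  have uv: "u k = y + t k *\<^sub>R v k" for k using t(1)[of k] by (simp add: v_def)
  have "(\<lambda>k. v k - v') \<longlonglongrightarrow> 0"
  proof (rule Lim_null_comparison)
    show "(\<lambda>k. c3 * norm (e k /\<^sub>R t k)) \<longlonglongrightarrow> 0"
      by (rule tendsto_mult_right_zero[OF tendsto_norm_zero[OF qlim]])
    show "\<forall>\<^sub>F k in sequentially. norm (v k - v') \<le> c3 * norm (e k /\<^sub>R t k)"
      using u
    proof eventually_elim
      case (elim k)
      have "v k - v' = (u k - (y + t k *\<^sub>R v')) /\<^sub>R t k"
        using t(1)[of k] by (simp add: v_def algebra_simps)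
      then show ?case using elim t(1)[of k] by (simp add: divide_simps mult_ac)
    qed
  qed
  then have v: "v \<longlonglongrightarrow> v'" by (rule LIM_zero_cancel)

  \<comment> \<open>The pulled back normals.\<close>
  define x where "x k = (g (y + t k *\<^sub>R v k) - ?z) /\<^sub>R t k" for k
  have x: "x \<longlonglongrightarrow> g' y v'" unfolding x_def by (rule has_derivative_sequentially[OF g t v])
  have gx: "g (u k) = ?z + t k *\<^sub>R x k" for k using t(1)[of k] by (simp add: x_def uv)
  define M where "M k = (adjoint (\<eta>' (g (u k))) (q k) - b) /\<^sub>R t k" for k
  have bM: "b + t k *\<^sub>R M k = adjoint (\<eta>' (g (u k))) (q k)" for k using t(1)[of k] by (simp add: M_def)
  define \<Delta> where "\<Delta> k = (\<eta>' (?z + t k *\<^sub>R x k) - \<eta>' ?z) /\<^sub>R t k - (\<eta>' (?z + t k *\<^sub>R w k) - \<eta>' ?z) /\<^sub>R t k"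
    for k
  have "\<Delta> \<longlonglongrightarrow> \<eta>'' (g' y v') - \<eta>'' (g' y v')"
    unfolding \<Delta>_def by (intro tendsto_diff has_derivative_sequentially[OF \<eta>''] t x w)
  then have \<Delta>: "\<Delta> \<longlonglongrightarrow> 0" by simp
  have "(\<lambda>k. M k - m k) \<longlonglongrightarrow> 0"
  proof (rule Lim_null_comparison)
    have "(\<lambda>k. norm (\<Delta> k) * (c1 * norm (b + t k *\<^sub>R m k))) \<longlonglongrightarrow> 0 * (c1 * norm b)"
      by (intro tendsto_intros tendsto_norm_zero[OF \<Delta>] shrink[OF m])
    then show "(\<lambda>k. norm (\<Delta> k) * (c1 * norm (b + t k *\<^sub>R m k))) \<longlonglongrightarrow> 0" by simp
    show "\<forall>\<^sub>F k in sequentially. norm (M k - m k) \<le> norm (\<Delta> k) * (c1 * norm (b + t k *\<^sub>R m k))"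
      using q
    proof eventually_elim
      case (elim k)
      have "t k *\<^sub>R (M k - m k) = (b + t k *\<^sub>R M k) - (b + t k *\<^sub>R m k)"
        by (simp add: scaleR_diff_right)
      also have "\<dots> = adjoint (\<eta>' (g (u k))) (q k) - adjoint (\<eta>' (z k)) (q k)"
        using elim by (simp only: bM)
      also have "\<dots> = adjoint (\<eta>' (g (u k)) - \<eta>' (z k)) (q k)"
        by (rule bounded_bilinear.diff_left[OF bounded_bilinear_adjoint, symmetric])
      also have "\<eta>' (g (u k)) - \<eta>' (z k) = t k *\<^sub>R \<Delta> k"
        using t(1)[of k] by (simp add: \<Delta>_def gx z_def flip: scaleR_diff_right)
      also have "adjoint (t k *\<^sub>R \<Delta> k) (q k) = t k *\<^sub>R adjoint (\<Delta> k) (q k)"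
        by (rule bounded_bilinear.scaleR_left[OF bounded_bilinear_adjoint])
      finally have "M k - m k = adjoint (\<Delta> k) (q k)" using t(1)[of k] by simp
      then have "norm (M k - m k) \<le> norm (\<Delta> k) * norm (q k)" by (simp add: norm_adjoint_le)
      also have "\<dots> \<le> norm (\<Delta> k) * (c1 * norm (b + t k *\<^sub>R m k))"
        using elim by (intro mult_left_mono) auto
      finally show ?case .
    qed
  qed
  from tendsto_add[OF this m] have M: "M \<longlonglongrightarrow> m'" by simp
  have "\<forall>\<^sub>F k in sequentially. b + t k *\<^sub>R M k \<in> normal_cone \<Theta> (g (y + t k *\<^sub>R v k))"
    using q u
  proof eventually_elim
    case (elim k)
    have "g (u k) \<in> V" using elim by (simp add: U_def)
    moreover have "q k \<in> normal_cone \<Xi> (\<eta> (g (u k)))" using elim by (simp add: h_def)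
    ultimately show ?case
      using adjoint_reduction_in_normal_cone[OF \<Theta>(2) V(1) _ red \<eta>]
      unfolding bM uv[symmetric] by blast
  qed
  with v M show ?thesis using that by blast
qed

text \<open>At interior points of \<open>\<Theta>\<close> normals vanish, and the variations are realized along
  straight lines.\<close>

lemma normal_variation_lift_interior:
  fixes g :: "'a::euclidean_space \<Rightarrow> 'b::euclidean_space" and D :: "'a \<Rightarrow> 'b"
  assumes g: "isCont g y" and int: "g y \<in> interior \<Theta>"
    and \<Theta>: "closed \<Theta>" "convex \<Theta>" and pdc: "projection_derivation_condition \<Theta> (g y)"
    and b: "b \<in> normal_cone \<Theta> (g y)"
    and m': "m' \<in> normal_cone (critical_cone \<Theta> (g y) b) (D v')"
    and t: "\<And>k. 0 < t k" "t \<longlonglongrightarrow> (0::real)"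
  obtains v m where "v \<longlonglongrightarrow> v'" "m \<longlonglongrightarrow> m'"
    "\<forall>\<^sub>F k in sequentially. b + t k *\<^sub>R m k \<in> normal_cone \<Theta> (g (y + t k *\<^sub>R v k))"
proof -
  obtain w m where w: "w \<longlonglongrightarrow> D v'" and m: "m \<longlonglongrightarrow> m'"
    and n: "\<And>k. b + t k *\<^sub>R m k \<in> normal_cone \<Theta> (g y + t k *\<^sub>R w k)"
    using normal_cone_variation_exists[OF \<Theta> pdc b t m'] by blast
  have shrink: "(\<lambda>k. p + t k *\<^sub>R x k) \<longlonglongrightarrow> p" if "x \<longlonglongrightarrow> x'"
    for p x' :: "'d::real_normed_vector" and x
    using tendsto_add[OF tendsto_const tendsto_scaleR[OF t(2) that]] by simp
  have "(\<lambda>k. g (y + t k *\<^sub>R v')) \<longlonglongrightarrow> g y"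
    by (rule isCont_tendsto_compose[OF g shrink[OF tendsto_const]])
  then have "\<forall>\<^sub>F k in sequentially. g (y + t k *\<^sub>R v') \<in> interior \<Theta>"
    by (rule topological_tendstoD[OF _ open_interior int])
  moreover have "\<forall>\<^sub>F k in sequentially. g y + t k *\<^sub>R w k \<in> interior \<Theta>"
    by (rule topological_tendstoD[OF shrink[OF w] open_interior int])
  ultimately have "\<forall>\<^sub>F k in sequentially. b + t k *\<^sub>R m k \<in> normal_cone \<Theta> (g (y + t k *\<^sub>R v'))"
  proof eventually_elim
    case (elim k)
    have "b + t k *\<^sub>R m k = 0" by (rule normal_cone_interior[OF n elim(2)])
    then show ?case using elim(1) interior_subset by (auto simp: normal_cone_iff)
  qed
  then show ?thesis using that[of "\<lambda>_. v'"] m by blast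
qed

section \<open>The generalized equation\<close>

text \<open>The generalized equation at a solution \<open>ybar\<close> for the parameter \<open>xbar\<close> with multiplier
  \<open>lbar\<close>, with derivatives as bounded linear maps. Here \<open>g''\<close> is the derivative at \<open>ybar\<close> of the
  derivative \<open>g'\<close>, and nondegeneracy and the projection derivation condition are assumed at
  \<open>g ybar\<close>.\<close>

locale multiplier_system =
  fixes f :: "'x::euclidean_space \<Rightarrow> real^'m \<Rightarrow> real^'m"
    and f' :: "'x \<times> (real^'m) \<Rightarrow> ('x \<times> (real^'m)) \<Rightarrow>\<^sub>L (real^'m)" and W :: "('x \<times> (real^'m)) set"
    and g :: "real^'m \<Rightarrow> 'z::euclidean_space" and g' :: "real^'m \<Rightarrow> (real^'m) \<Rightarrow>\<^sub>L 'z"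
    and g'' :: "real^'m \<Rightarrow> (real^'m) \<Rightarrow>\<^sub>L 'z"
    and \<Theta> :: "'z set" and xbar :: 'x and ybar :: "real^'m" and lbar :: 'z
  assumes W: "open W" "(xbar, ybar) \<in> W"
    and f: "\<And>p. p \<in> W \<Longrightarrow> ((\<lambda>(x, y). f x y) has_derivative f' p) (at p)"
    and f'_cont: "continuous_on W f'"
    and g: "\<And>y. (g has_derivative g' y) (at y)"
    and g'_cont: "continuous_on UNIV g'"
    and g'': "(g' has_derivative g'') (at ybar)"
    and \<Theta>: "closed \<Theta>" "convex \<Theta>"
    and nondegenerate: "{g' ybar u + w | u w. w \<in> lin (tangent_cone \<Theta> (g ybar))} = UNIV"
    and pdc: "projection_derivation_condition \<Theta> (g ybar)"
    and lbar: "lbar \<in> normal_cone \<Theta> (g ybar)" "f xbar ybar + adjoint (g' ybar) lbar = 0"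
begin

text \<open>The left-hand side of the equation \<open>\<Phi> (x, y, l) = 0\<close> that a solution \<open>y\<close> for the parameter \<open>x\<close>
  satisfies with its multiplier \<open>l\<close>, and its derivative at \<open>(xbar, ybar, lbar)\<close>. The adjoint
  generalized equation asks for \<open>\<Phi>' (0, v, m) = 0\<close> with \<open>m\<close> normal to the critical cone at
  \<open>g' ybar v\<close>.\<close>

definition \<Phi> :: "'x \<times> (real^'m) \<times> 'z \<Rightarrow> real^'m"
  where "\<Phi> = (\<lambda>(x, y, l). f x y + adjoint (g' y) l)"

definition \<Phi>' :: "'x \<times> (real^'m) \<times> 'z \<Rightarrow> real^'m"
  where "\<Phi>' = (\<lambda>(a, v, m). f' (xbar, ybar) (a, v) + (adjoint (g'' v) lbar + adjoint (g' ybar) m))"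

lemma has_derivative_\<Phi>: "(\<Phi> has_derivative \<Phi>') (at (xbar, ybar, lbar))"
proof -
  let ?p = "(xbar, ybar, lbar)"
  have "((\<lambda>q. (fst q, fst (snd q))) has_derivative (\<lambda>h. (fst h, fst (snd h)))) (at ?p)"
    by (auto intro!: derivative_eq_intros)
  from diff_chain_at[OF this, of "\<lambda>(x, y). f x y" "f' (xbar, ybar)"] f[OF W(2)]
  have 1: "((\<lambda>q. f (fst q) (fst (snd q))) has_derivative
      (\<lambda>h. f' (xbar, ybar) (fst h, fst (snd h)))) (at ?p)"
    by (simp add: comp_def)
  have "((\<lambda>q. fst (snd q)) has_derivative (\<lambda>h. fst (snd h))) (at ?p)"
    by (auto intro!: derivative_eq_intros)
  from diff_chain_at[OF this] g''
  have 2: "((\<lambda>q. g' (fst (snd q))) has_derivative (\<lambda>h. g'' (fst (snd h)))) (at ?p)"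
    by (simp add: comp_def)
  have 3: "((\<lambda>q. snd (snd q)) has_derivative (\<lambda>h. snd (snd h))) (at ?p)"
    by (auto intro!: derivative_eq_intros)
  have "((\<lambda>q. f (fst q) (fst (snd q)) + adjoint (g' (fst (snd q))) (snd (snd q))) has_derivative
      (\<lambda>h. f' (xbar, ybar) (fst h, fst (snd h)) +
        (adjoint (g' (fst (snd ?p))) (snd (snd h)) + adjoint (g'' (fst (snd h))) (snd (snd ?p)))))
      (at ?p)"
    by (intro has_derivative_add 1 bounded_bilinear.FDERIV[OF bounded_bilinear_adjoint 2 3])
  then show ?thesis by (simp add: \<Phi>_def \<Phi>'_def case_prod_unfold add.commute)
qed

lemma \<Phi>_bar: "\<Phi> (xbar, ybar, lbar) = 0"
  using lbar(2) by (simp add: \<Phi>_def)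

lemma adjoint_eq_0_iff:
  assumes "\<And>w. w \<in> lin (tangent_cone \<Theta> (g ybar)) \<Longrightarrow> m \<bullet> w = 0" "adjoint (g' ybar) m = 0"
  shows "m = 0"
  using nondegenerate_adjoint_inj[OF nondegenerate] assms by blast

lemma multiplier_unique:
  assumes "l \<in> normal_cone \<Theta> (g ybar)" "f xbar ybar + adjoint (g' ybar) l = 0"
  shows "l = lbar"
proof -
  have "l - lbar = 0"
  proof (rule adjoint_eq_0_iff)
    show "(l - lbar) \<bullet> w = 0" if "w \<in> lin (tangent_cone \<Theta> (g ybar))" for w
      using normal_cone_orthogonal_lin[OF \<Theta>(2) _ that] assms(1) lbar(1) by (simp add: inner_diff_left)
    have "adjoint (g' ybar) (l - lbar) = adjoint (g' ybar) l - adjoint (g' ybar) lbar"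
      by (rule bounded_bilinear.diff_right[OF bounded_bilinear_adjoint])
    then show "adjoint (g' ybar) (l - lbar) = 0"
      using assms(2) lbar(2) by (metis add_left_cancel diff_self)
  qed
  then show ?thesis by simp
qed

lemma g_isCont: "isCont g y"
  by (rule has_derivative_continuous[OF g])

lemma g'_isCont: "isCont g' y"
  using g'_cont by (simp add: continuous_on_eq_continuous_at)

lemma solution_mapI:
  assumes "l \<in> normal_cone \<Theta> (g y)" "\<Phi> (x, y, l) = 0"
  shows "y \<in> solution_map f (g -` \<Theta>) x"
proof -
  have "adjoint (g' y) l \<in> regular_normal_cone (g -` \<Theta>) y"
    by (rule adjoint_in_regular_normal_cone_vimage[OF g assms(1)])
  moreover have "0 = f x y + adjoint (g' y) l" using assms(2) by (simp add: \<Phi>_def)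
  ultimately show ?thesis unfolding solution_map_def by blast
qed

text \<open>Near the reference point every solution has a multiplier, and these multipliers are bounded.\<close>

lemma solution_map_multiplier:
  obtains d B where "0 < d"
    "\<And>x y. dist x xbar < d \<Longrightarrow> dist y ybar < d \<Longrightarrow> y \<in> solution_map f (g -` \<Theta>) x \<Longrightarrow>
      \<exists>l \<in> normal_cone \<Theta> (g y). \<Phi> (x, y, l) = 0 \<and> norm l \<le> B"
proof -
  have "w = 0" if "w \<in> normal_cone \<Theta> (g ybar)" "adjoint (g' ybar) w = 0" for w
    using adjoint_eq_0_iff normal_cone_orthogonal_lin[OF \<Theta>(2) that(1)] that(2) by blast
  then obtain d1 c where "0 < d1" "0 < c" and est: "\<And>y z w. dist y ybar < d1 \<Longrightarrow>
      dist z (g ybar) < d1 \<Longrightarrow> w \<in> normal_cone \<Theta> z \<Longrightarrow> norm w \<le> c * norm (adjoint (g' y) w)"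
    using normal_cone_adjoint_estimate[where C = \<Theta> and G = g' and p = ybar and z = "g ybar",
        OF \<Theta>(1) g'_isCont] by blast
  obtain d2 where "0 < d2" and d2: "\<And>y. dist y ybar < d2 \<Longrightarrow> dist (g y) (g ybar) < d1"
    using g_isCont[of ybar] \<open>0 < d1\<close> unfolding continuous_at_eps_delta by metis
  have "isCont (\<lambda>(x, y). f x y) (xbar, ybar)" by (rule has_derivative_continuous[OF f[OF W(2)]])
  then obtain d3 where "0 < d3" and d3: "\<And>p. dist p (xbar, ybar) < d3 \<Longrightarrow>
      dist (case p of (x, y) \<Rightarrow> f x y) (f xbar ybar) < 1"
    unfolding continuous_at_eps_delta by (metis (no_types, lifting) case_prod_conv zero_less_one)
  show ?thesis
  proof (rule that)
    show "0 < min (min d1 d2) (d3 / 2)" using \<open>0 < d1\<close> \<open>0 < d2\<close> \<open>0 < d3\<close> by simp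
    fix x y
    assume x: "dist x xbar < min (min d1 d2) (d3 / 2)" and y: "dist y ybar < min (min d1 d2) (d3 / 2)"
      and "y \<in> solution_map f (g -` \<Theta>) x"
    then obtain v where v: "v \<in> regular_normal_cone (g -` \<Theta>) y" "f x y + v = 0"
      by (auto simp: solution_map_def)
    have est': "norm w \<le> c * norm (adjoint (g' y) w)" if "w \<in> normal_cone \<Theta> (g y)" for w
      using est[of y "g y" w] d2[of y] y that by simp
    then have "w = 0" if "w \<in> normal_cone \<Theta> (g y)" "adjoint (g' y) w = 0" for w
      using that by fastforce
    then obtain l where l: "l \<in> normal_cone \<Theta> (g y)" "v = adjoint (g' y) l"
      using regular_normal_cone_vimage_multiplier[OF g \<Theta> g'_isCont _ v(1)] by blast
    have "dist (x, y) (xbar, ybar) \<le> dist x xbar + dist y ybar"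
      by (simp add: dist_Pair_Pair sqrt_sum_squares_le_sum)
    then have "dist (f x y) (f xbar ybar) < 1" using x y d3[of "(x, y)"] by simp
    then have "norm (f x y) \<le> norm (f xbar ybar) + 1"
      using norm_triangle_ineq2[of "f x y" "f xbar ybar"] by (simp add: dist_norm)
    moreover have "norm v = norm (f x y)" using v(2) by (metis add_eq_0_iff norm_minus_cancel)
    ultimately have "norm l \<le> c * (norm (f xbar ybar) + 1)"
      using est'[OF l(1)] l(2) \<open>0 < c\<close> by (metis less_imp_le mult_left_mono order_trans)
    then show "\<exists>l\<in>normal_cone \<Theta> (g y). \<Phi> (x, y, l) = 0 \<and> norm l \<le> c * (norm (f xbar ybar) + 1)"
      using l v(2) by (auto simp: \<Phi>_def)
  qed
qed

text \<open>Solutions and multipliers that converge to the reference triple, rescaled by \<open>s\<close>, satisfy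
  the linearized system in the limit.\<close>

lemma linearized_system_limit:
  assumes s: "\<And>k. 0 < s k" "s \<longlonglongrightarrow> (0::real)"
    and lim: "a \<longlonglongrightarrow> a'" "w \<longlonglongrightarrow> w'" "m \<longlonglongrightarrow> m'"
    and sol: "\<And>k. lbar + s k *\<^sub>R m k \<in> normal_cone \<Theta> (g (ybar + s k *\<^sub>R w k))"
      "\<And>k. \<Phi> (xbar + s k *\<^sub>R a k, ybar + s k *\<^sub>R w k, lbar + s k *\<^sub>R m k) = 0"
  shows "\<Phi>' (a', w', m') = 0"
    and "m' \<in> normal_cone (critical_cone \<Theta> (g ybar) lbar) (g' ybar w')"
proof -
  have "(\<lambda>k. (\<Phi> ((xbar, ybar, lbar) + s k *\<^sub>R (a k, w k, m k)) - \<Phi> (xbar, ybar, lbar)) /\<^sub>R s k)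
      \<longlonglongrightarrow> \<Phi>' (a', w', m')"
    by (intro has_derivative_sequentially[OF has_derivative_\<Phi>] s tendsto_Pair lim)
  then have "(\<lambda>k. 0) \<longlonglongrightarrow> \<Phi>' (a', w', m')" by (simp add: sol(2) \<Phi>_bar)
  then show "\<Phi>' (a', w', m') = 0" using LIMSEQ_unique tendsto_const by blast
  define z where "z k = (g (ybar + s k *\<^sub>R w k) - g ybar) /\<^sub>R s k" for k
  have z: "z \<longlonglongrightarrow> g' ybar w'"
    unfolding z_def[abs_def] by (rule has_derivative_sequentially[OF g s lim(2)])
  have "g (ybar + s k *\<^sub>R w k) = g ybar + s k *\<^sub>R z k" for k using s(1)[of k] by (simp add: z_def)
  then show "m' \<in> normal_cone (critical_cone \<Theta> (g ybar) lbar) (g' ybar w')"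
    using normal_cone_variation_limit[OF \<Theta> pdc lbar(1) s z lim(3)] sol(1) by simp
qed

text \<open>Solutions that violate calmness are rescaled by \<open>|y - ybar| + |l - lbar|\<close>, the deviation of
  the solution together with its multiplier \<open>l\<close>. A limit \<open>(w, m)\<close> has \<open>w = 0\<close> by the assumption on
  the adjoint equation, and then \<open>m = 0\<close> by nondegeneracy, against the normalization.\<close>

lemma isolated_calmness_sufficient:
  assumes adj: "\<And>v m. m \<in> normal_cone (critical_cone \<Theta> (g ybar) lbar) (g' ybar v) \<Longrightarrow>
      \<Phi>' (0, v, m) = 0 \<Longrightarrow> v = 0"
  shows "isolated_calmness (solution_map f (g -` \<Theta>)) xbar ybar"
proof (rule ccontr)
  let ?S = "solution_map f (g -` \<Theta>)"
  assume not: "\<not> isolated_calmness ?S xbar ybar"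
  have "ybar \<in> ?S xbar" using solution_mapI[OF lbar(1) \<Phi>_bar] .
  with not have ex: "\<exists>x y. dist x xbar < r \<and> dist y ybar < r \<and> y \<in> ?S x \<and> c * norm (x - xbar) < norm (y - ybar)"
    if "0 < r" "0 < c" for r c :: real
  proof -
    have "\<not> (\<forall>x\<in>ball xbar r. ?S x \<inter> ball ybar r \<subseteq> cball ybar (c * norm (x - xbar)))"
    proof
      assume *: "\<forall>x\<in>ball xbar r. ?S x \<inter> ball ybar r \<subseteq> cball ybar (c * norm (x - xbar))"
      have "isolated_calmness ?S xbar ybar"
        unfolding isolated_calmness_def using \<open>ybar \<in> ?S xbar\<close> that *
        by (intro conjI exI[of _ "ball xbar r"] exI[of _ "ball ybar r"] exI[of _ c]) auto
      with not show False ..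
    qed
    then show ?thesis by (force simp: dist_norm norm_minus_commute not_le)
  qed
  obtain d B where "0 < d" and mult: "\<And>x y. dist x xbar < d \<Longrightarrow> dist y ybar < d \<Longrightarrow> y \<in> ?S x \<Longrightarrow>
      \<exists>l \<in> normal_cone \<Theta> (g y). \<Phi> (x, y, l) = 0 \<and> norm l \<le> B"
    using solution_map_multiplier by blast
  define \<epsilon> where "\<epsilon> k = d / real (Suc k)" for k
  have \<epsilon>: "0 < \<epsilon> k" "\<epsilon> k \<le> d" for k
    using \<open>0 < d\<close> by (auto simp: \<epsilon>_def divide_simps)
  have \<epsilon>lim: "\<epsilon> \<longlonglongrightarrow> 0"
    unfolding \<epsilon>_def using tendsto_mult_right_zero[OF LIMSEQ_Suc[OF lim_1_over_n], of d] by simp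
  have "\<exists>x y l. dist x xbar < \<epsilon> k \<and> dist y ybar < \<epsilon> k \<and> real (Suc k) * norm (x - xbar) < norm (y - ybar) \<and>
      l \<in> normal_cone \<Theta> (g y) \<and> \<Phi> (x, y, l) = 0 \<and> norm l \<le> B" for k
  proof -
    obtain x y where xy: "dist x xbar < \<epsilon> k" "dist y ybar < \<epsilon> k" "y \<in> ?S x"
      "real (Suc k) * norm (x - xbar) < norm (y - ybar)"
      using ex[OF \<epsilon>(1)[of k], of "real (Suc k)"] by auto
    moreover have "dist x xbar < d" "dist y ybar < d" using xy \<epsilon>(2)[of k] by auto
    ultimately show ?thesis using mult by blast
  qed
  then obtain x0 y0 l0 where *: "\<And>k. dist (x0 k) xbar < \<epsilon> k" "\<And>k. dist (y0 k) ybar < \<epsilon> k"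
    "\<And>k. real (Suc k) * norm (x0 k - xbar) < norm (y0 k - ybar)" "\<And>k. l0 k \<in> normal_cone \<Theta> (g (y0 k))"
    "\<And>k. \<Phi> (x0 k, y0 k, l0 k) = 0" "\<And>k. norm (l0 k) \<le> B"
    by metis
  have x0: "x0 \<longlonglongrightarrow> xbar" and y0: "y0 \<longlonglongrightarrow> ybar"
    by (rule metric_tendsto_imp_tendsto[OF \<epsilon>lim];
        use *(1,2) \<epsilon>(1) in \<open>auto intro!: always_eventually less_imp_le simp: abs_of_pos\<close>)+

  \<comment> \<open>The multipliers converge to \<open>lbar\<close> along a subsequence.\<close>
  have "\<forall>k. l0 k \<in> cball 0 B" using *(6) by simp
  then obtain l' r where r: "strict_mono (r :: nat \<Rightarrow> nat)" and l0: "(\<lambda>k. l0 (r k)) \<longlonglongrightarrow> l'"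
    using compact_cball[of 0 B] unfolding compact_def comp_def by metis
  define x y l where "x = (\<lambda>k. x0 (r k))" and "y = (\<lambda>k. y0 (r k))" and "l = (\<lambda>k. l0 (r k))"
  note sub = LIMSEQ_subseq_LIMSEQ[OF _ r, unfolded comp_def]
  have x: "x \<longlonglongrightarrow> xbar" and y: "y \<longlonglongrightarrow> ybar" and l': "l \<longlonglongrightarrow> l'"
    using sub[OF x0] sub[OF y0] l0 by (simp_all add: x_def y_def l_def)
  have ln: "l k \<in> normal_cone \<Theta> (g (y k))" and \<Phi>0: "\<Phi> (x k, y k, l k) = 0" for k
    using *(4,5) by (simp_all add: x_def y_def l_def)
  have xy: "real (Suc k) * norm (x k - xbar) < norm (y k - ybar)" for k
  proof -
    have "real (Suc k) \<le> real (Suc (r k))" using seq_suble[OF r, of k] by simp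
    then have "real (Suc k) * norm (x k - xbar) \<le> real (Suc (r k)) * norm (x k - xbar)"
      by (rule mult_right_mono) simp
    also have "\<dots> < norm (y k - ybar)" using *(3)[of "r k"] by (simp add: x_def y_def)
    finally show ?thesis .
  qed
  have "l' \<in> normal_cone \<Theta> (g ybar)"
    by (rule normal_cone_closed_graph[OF \<Theta>(1) l' isCont_tendsto_compose[OF g_isCont y] ln])
  moreover have "f xbar ybar + adjoint (g' ybar) l' = 0"
  proof (rule LIMSEQ_unique)
    have "isCont (\<lambda>(x, y). f x y) (xbar, ybar)" by (rule has_derivative_continuous[OF f[OF W(2)]])
    from isCont_tendsto_compose[OF this tendsto_Pair[OF x y]]
    have "(\<lambda>k. f (x k) (y k)) \<longlonglongrightarrow> f xbar ybar" by simp
    then show "(\<lambda>k. f (x k) (y k) + adjoint (g' (y k)) (l k)) \<longlonglongrightarrow> f xbar ybar + adjoint (g' ybar) l'"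
      by (intro tendsto_intros l' isCont_tendsto_compose[OF g'_isCont y])
    show "(\<lambda>k. f (x k) (y k) + adjoint (g' (y k)) (l k)) \<longlonglongrightarrow> 0"
      using \<Phi>0 by (simp add: \<Phi>_def)
  qed
  ultimately have "l' = lbar" by (rule multiplier_unique)
  with l' have l: "l \<longlonglongrightarrow> lbar" by simp

  define s where "s k = norm (y k - ybar) + norm (l k - lbar)" for k
  have s: "0 < s k" for k
  proof -
    have "0 \<le> real (Suc k) * norm (x k - xbar)" by simp
    then have "0 < norm (y k - ybar)" using xy[of k] by linarith
    then show ?thesis unfolding s_def by (rule add_pos_nonneg) simp
  qed
  have "s \<longlonglongrightarrow> 0 + 0"
    unfolding s_def[abs_def]
    by (intro tendsto_add tendsto_norm_zero LIM_zero y l)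
  then have slim: "s \<longlonglongrightarrow> 0" by simp
  define a w m where "a k = (x k - xbar) /\<^sub>R s k" and "w k = (y k - ybar) /\<^sub>R s k"
    and "m k = (l k - lbar) /\<^sub>R s k" for k
  have nwm: "norm (w k) + norm (m k) = 1" for k
    using s[of k] by (simp add: w_def m_def flip: distrib_left) (simp add: s_def)
  have a: "a \<longlonglongrightarrow> 0"
  proof (rule Lim_null_comparison[OF _ LIMSEQ_Suc[OF lim_1_over_n]])
    show "\<forall>\<^sub>F k in sequentially. norm (a k) \<le> 1 / real (Suc k)"
    proof (rule always_eventually, rule allI)
      fix k
      have "real (Suc k) * norm (x k - xbar) \<le> s k" using xy[of k] norm_ge_zero[of "l k - lbar"]
        unfolding s_def by linarith
      then show "norm (a k) \<le> 1 / real (Suc k)"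
        using s[of k] by (simp only: a_def norm_scaleR) (simp add: divide_simps mult.commute)
    qed
  qed
  have "norm (w k, m k) \<le> 1" for k
    using norm_Pair_le[of "w k" "m k"] by (simp add: nwm)
  then have "(w k, m k) \<in> cball 0 1" for k by simp
  then have "\<exists>q\<in>cball 0 1. \<exists>r'. strict_mono r' \<and> ((\<lambda>k. (w k, m k)) \<circ> r') \<longlonglongrightarrow> q"
    by (rule compact_cball[unfolded compact_def, rule_format])
  then obtain q r' where r': "strict_mono (r' :: nat \<Rightarrow> nat)"
    and "((\<lambda>k. (w k, m k)) \<circ> r') \<longlonglongrightarrow> q" by blast
  then have q: "(\<lambda>k. (w (r' k), m (r' k))) \<longlonglongrightarrow> q" by (simp add: comp_def)
  obtain w' m' where "q = (w', m')" by fastforce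
  then have w: "(\<lambda>k. w (r' k)) \<longlonglongrightarrow> w'" and m: "(\<lambda>k. m (r' k)) \<longlonglongrightarrow> m'"
    using tendsto_fst[OF q] tendsto_snd[OF q] by simp_all
  note sub' = LIMSEQ_subseq_LIMSEQ[OF _ r', unfolded comp_def]
  have eq: "xbar + s k *\<^sub>R a k = x k" "ybar + s k *\<^sub>R w k = y k" "lbar + s k *\<^sub>R m k = l k" for k
    using s[of k] by (simp_all add: a_def w_def m_def)
  have lin: "\<Phi>' (0, w', m') = 0" "m' \<in> normal_cone (critical_cone \<Theta> (g ybar) lbar) (g' ybar w')"
    by (rule linearized_system_limit[OF s sub'[OF slim] sub'[OF a] w m]; simp add: eq ln \<Phi>0)+
  then have "w' = 0" using adj by blast
  have "m' = 0"
  proof (rule adjoint_eq_0_iff)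
    show "adjoint (g' ybar) m' = 0"
      using lin(1) \<open>w' = 0\<close> linear_0[OF has_derivative_linear[OF g'']]
        bounded_bilinear.zero_left[OF bounded_bilinear_adjoint[where 'a = "real^'m"], of lbar]
      by (simp add: \<Phi>'_def flip: zero_prod_def)
    have sub: "subspace (lin (tangent_cone \<Theta> (g ybar)))"
      using lbar(1) by (intro subspace_lin convex_tangent_cone cone_tangent_cone
          zero_in_tangent_cone \<Theta>) (simp_all add: normal_cone_iff)
    show "m' \<bullet> v = 0" if "v \<in> lin (tangent_cone \<Theta> (g ybar))" for v
    proof -
      have le: "m' \<bullet> u \<le> 0" if "u \<in> lin (tangent_cone \<Theta> (g ybar))" for u
        using lin(2) lin_subset_critical_cone[OF \<Theta>(2) lbar(1)] that \<open>w' = 0\<close>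
        by (auto simp: normal_cone_iff)
      show ?thesis using le[OF that] le[OF subspace_neg[OF sub that]] by simp
    qed
  qed
  have "(\<lambda>k. norm (w (r' k)) + norm (m (r' k))) \<longlonglongrightarrow> norm w' + norm m'"
    by (intro tendsto_intros w m)
  then have "(\<lambda>k. 1::real) \<longlonglongrightarrow> 0" using \<open>w' = 0\<close> \<open>m' = 0\<close> by (simp add: nwm)
  then show False using LIMSEQ_unique[OF tendsto_const] by fastforce
qed

text \<open>Conversely, a solution of the linearized system is the initial velocity of solutions of the
  generalized equation for parameters at a distance \<open>o(t)\<close> from \<open>xbar\<close>: variations of normals lift
  to pairs \<open>(y, l)\<close> with a residual of order \<open>o(t)\<close>, and surjectivity of the partial derivative
  in the parameter makes it possible to remove the residual.\<close>

lemma isolated_calmness_necessary: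
  assumes surj: "surj (\<lambda>a. f' (xbar, ybar) (a, 0))"
    and lift: "\<And>v' m' t. m' \<in> normal_cone (critical_cone \<Theta> (g ybar) lbar) (g' ybar v') \<Longrightarrow>
      (\<And>k::nat. 0 < t k) \<Longrightarrow> t \<longlonglongrightarrow> (0::real) \<Longrightarrow> \<exists>v m. v \<longlonglongrightarrow> v' \<and> m \<longlonglongrightarrow> m' \<and>
        (\<forall>\<^sub>F k in sequentially. lbar + t k *\<^sub>R m k \<in> normal_cone \<Theta> (g (ybar + t k *\<^sub>R v k)))"
    and calm: "isolated_calmness (solution_map f (g -` \<Theta>)) xbar ybar"
    and m': "m' \<in> normal_cone (critical_cone \<Theta> (g ybar) lbar) (g' ybar v')" "\<Phi>' (0, v', m') = 0"
  shows "v' = 0"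
proof -
  let ?S = "solution_map f (g -` \<Theta>)"
  define t where "t k = 1 / real (Suc k)" for k
  have t: "0 < t k" for k by (simp add: t_def)
  have tlim: "t \<longlonglongrightarrow> 0" unfolding t_def by (rule LIMSEQ_Suc[OF lim_1_over_n])
  obtain v m where v: "v \<longlonglongrightarrow> v'" and m: "m \<longlonglongrightarrow> m'" and
    n: "\<forall>\<^sub>F k in sequentially. lbar + t k *\<^sub>R m k \<in> normal_cone \<Theta> (g (ybar + t k *\<^sub>R v k))"
    using lift[OF m'(1) t tlim] by blast
  define y l where "y k = ybar + t k *\<^sub>R v k" and "l k = lbar + t k *\<^sub>R m k" for k
  have y: "y \<longlonglongrightarrow> ybar"
    unfolding y_def[abs_def] using tendsto_add[OF tendsto_const tendsto_scaleR[OF tlim v]] by simp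
  define e where "e k = \<Phi> (xbar, y k, l k)" for k
  have "(\<lambda>k. (\<Phi> ((xbar, ybar, lbar) + t k *\<^sub>R (0, v k, m k)) - \<Phi> (xbar, ybar, lbar)) /\<^sub>R t k)
      \<longlonglongrightarrow> \<Phi>' (0, v', m')"
    by (intro has_derivative_sequentially[OF has_derivative_\<Phi>] t tlim tendsto_Pair tendsto_const v m)
  then have q: "(\<lambda>k. e k /\<^sub>R t k) \<longlonglongrightarrow> 0" by (simp add: m'(2) \<Phi>_bar e_def y_def l_def)
  from tendsto_scaleR[OF tlim this] have e: "e \<longlonglongrightarrow> 0" using t by (simp add: less_imp_neq[symmetric])

  \<comment> \<open>The map \<open>(x, y) \<mapsto> (f x y, y)\<close> lets the parameter be adjusted while \<open>y\<close> is kept.\<close>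
  define F where "F p = (case p of (x, y) \<Rightarrow> (f x y, y))" for p
  have bl1: "bounded_linear (\<lambda>u::real^'m. (u, 0::real^'m))"
    and bl2: "bounded_linear (\<lambda>h::'x \<times> (real^'m). (0::real^'m, snd h))"
    by (auto intro!: bounded_linear_Pair bounded_linear_ident bounded_linear_zero bounded_linear_snd)
  define F' where "F' p = (Blinfun (\<lambda>u::real^'m. (u, 0::real^'m)) o\<^sub>L f' p)
      + Blinfun (\<lambda>h::'x \<times> (real^'m). (0::real^'m, snd h))" for p
  have F'_apply: "F' p h = (f' p h, snd h)" for p h
    by (simp add: F'_def blinfun.add_left blinfun_compose.rep_eq bounded_linear_Blinfun_apply bl1 bl2)
  have F: "(F has_derivative F' p) (at p)" if "p \<in> W" for p
  proof -
    have "((\<lambda>p. ((case p of (x, y) \<Rightarrow> f x y), snd p)) has_derivative (\<lambda>h. (f' p h, snd h))) (at p)"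
      by (intro has_derivative_Pair f that has_derivative_snd has_derivative_ident)
    then show ?thesis by (simp add: F_def[abs_def] F'_apply[abs_def] case_prod_unfold)
  qed
  have F'cont: "continuous_on W F'"
    unfolding F'_def[abs_def]
    by (intro continuous_on_add continuous_on_const f'_cont
        bounded_bilinear.continuous_on[OF bounded_bilinear_blinfun_compose])
  have F'surj: "surj (blinfun_apply (F' (xbar, ybar)))"
  proof (rule surjI)
    fix q :: "(real^'m) \<times> (real^'m)"
    obtain a where a: "fst q - f' (xbar, ybar) (0, snd q) = f' (xbar, ybar) (a, 0)"
      using surj by (rule surjE)
    have "f' (xbar, ybar) (a, snd q) = f' (xbar, ybar) (a, 0) + f' (xbar, ybar) (0, snd q)"
      by (simp flip: blinfun.add_right)
    then have "F' (xbar, ybar) (a, snd q) = q" by (simp add: F'_apply flip: a)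
    then show "F' (xbar, ybar) (SOME h. F' (xbar, ybar) h = q) = q" by (rule someI)
  qed
  obtain d c where "0 < d" "0 < c" and sol: "solvable_near F W (xbar, ybar) d c"
    using surjective_derivative_solvable[OF W F F'cont F'surj] by blast
  have "\<forall>\<^sub>F k in sequentially. dist (y k) ybar < d \<and> dist (e k) 0 < d"
    using y e \<open>0 < d\<close> by (intro eventually_conj) (auto simp: tendsto_iff)
  then have "\<forall>\<^sub>F k in sequentially. \<exists>x. \<Phi> (x, y k, l k) = 0 \<and> norm (x - xbar) \<le> c * norm (e k)"
  proof eventually_elim
    case (elim k)
    let ?w = "(- adjoint (g' (y k)) (l k), y k)"
    have res: "?w - F (xbar, y k) = (- e k, 0)" by (simp add: F_def e_def \<Phi>_def)
    obtain p where p: "F p = ?w" "norm (p - (xbar, y k)) \<le> c * norm (?w - F (xbar, y k))"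
    proof (rule solvable_nearE[OF sol])
      show "dist (xbar, y k) (xbar, ybar) < d" using elim by (simp add: dist_Pair_Pair)
      show "norm (?w - F (xbar, y k)) < d" using elim unfolding res by (simp add: norm_Pair)
    qed
    obtain x where x: "p = (x, y k)" using p(1) by (cases p) (simp add: F_def)
    have "\<Phi> (x, y k, l k) = 0" using p(1) by (simp add: x F_def \<Phi>_def)
    moreover have "norm (x - xbar) \<le> c * norm (e k)"
      using p(2) unfolding res by (simp add: x norm_Pair)
    ultimately show ?case by blast
  qed
  then obtain x where x: "\<forall>\<^sub>F k in sequentially. \<Phi> (x k, y k, l k) = 0 \<and> norm (x k - xbar) \<le> c * norm (e k)"
    unfolding eventually_ex by blast
  have "(\<lambda>k. x k - xbar) \<longlonglongrightarrow> 0"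
    by (rule Lim_null_comparison[OF _ tendsto_mult_right_zero[OF tendsto_norm_zero[OF e], of c]])
      (use x in \<open>auto elim: eventually_mono\<close>)
  then have xlim: "x \<longlonglongrightarrow> xbar" by (rule LIM_zero_cancel)
  obtain U V C where UV: "open U" "xbar \<in> U" "open V" "ybar \<in> V" "0 < C" and
    C: "\<And>x. x \<in> U \<Longrightarrow> ?S x \<inter> V \<subseteq> cball ybar (C * norm (x - xbar))"
    using calm unfolding isolated_calmness_def by metis
  have "\<forall>\<^sub>F k in sequentially. norm (v k) \<le> C * (c * norm (e k /\<^sub>R t k))"
    using x n topological_tendstoD[OF xlim UV(1,2)] topological_tendstoD[OF y UV(3,4)]
  proof eventually_elim
    case (elim k)
    have "y k \<in> ?S (x k)"
      using elim(1,2) by (intro solution_mapI) (auto simp: y_def l_def)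
    then have "norm (y k - ybar) \<le> C * norm (x k - xbar)"
      using C[OF elim(3)] elim(4) by (auto simp: dist_norm norm_minus_commute)
    also have "\<dots> \<le> C * (c * norm (e k))" using elim(1) \<open>0 < C\<close> by (intro mult_left_mono) auto
    finally have "t k * norm (v k) \<le> C * (c * norm (e k))" using t[of k] by (simp add: y_def)
    then show ?case using t[of k] by (simp add: divide_simps mult_ac)
  qed
  moreover have "(\<lambda>k. C * (c * norm (e k /\<^sub>R t k))) \<longlonglongrightarrow> 0"
    by (intro tendsto_mult_right_zero tendsto_norm_zero q)
  ultimately have "v \<longlonglongrightarrow> 0" by (rule Lim_null_comparison)
  then show ?thesis using v LIMSEQ_unique by blast
qed

end

section \<open>Translation to Jacobian matrices\<close>

lemma
  fixes f :: "real^'a \<Rightarrow> real^'b"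
  assumes "(f has_derivative f') (at x)"
  shows jacobian_apply: "jacobian f (at x) *v h = f' h"
    and transpose_jacobian_apply: "transpose (jacobian f (at x)) *v l = adjoint f' l"
proof -
  have "f' = (\<lambda>h. jacobian f (at x) *v h)"
    using assms jacobian_works differentiableI has_derivative_unique by metis
  then show "jacobian f (at x) *v h = f' h"
    and "transpose (jacobian f (at x)) *v l = adjoint f' l"
    by (metis, metis adjoint_matrix)
qed

theorem theorem6p3:
  fixes f :: "real^'n \<Rightarrow> real^'m \<Rightarrow> real^'m"
    and g :: "real^'m \<Rightarrow> real^'l"
    and \<Theta> :: "(real^'l) set"
    and \<Xi> :: "(real^'q) set"
    and xbar :: "real^'n" and ybar :: "real^'m"
  assumes "C2_on UNIV g"
    and "closed \<Theta>" "convex \<Theta>" "cone \<Theta>"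
    and "ybar \<in> solution_map f (g -` \<Theta>) xbar"
    and "\<exists>W. open W \<and> (xbar, ybar) \<in> W \<and> C1_on W (\<lambda>(x, y). f x y)"
    and "pointed_C2_reducible \<Theta> (g ybar) \<Xi>"
    and "nondegenerate g \<Theta> ybar"
    and "dir_differentiable (closest_point \<Theta>)"
    and "projection_derivation_condition \<Theta> (g ybar)"
  shows "(\<exists>!lam. lam \<in> lagrange_multipliers f g \<Theta> xbar ybar) \<and>
    (\<forall>lam \<in> lagrange_multipliers f g \<Theta> xbar ybar.
      (adjoint_solutions f g \<Theta> xbar ybar lam = {0} \<longrightarrow>
        isolated_calmness (solution_map f (g -` \<Theta>)) xbar ybar) \<and>
      (surj (\<lambda>h. jacobian (\<lambda>x. f x ybar) (at xbar) *v h) \<longrightarrow>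
        isolated_calmness (solution_map f (g -` \<Theta>)) xbar ybar \<longrightarrow>
        adjoint_solutions f g \<Theta> xbar ybar lam = {0}))"
proof -
  let ?S = "solution_map f (g -` \<Theta>)" and ?L = "lagrange_multipliers f g \<Theta> xbar ybar"
  obtain g' :: "real^'m \<Rightarrow> (real^'m) \<Rightarrow>\<^sub>L (real^'l)" where g: "\<And>y. (g has_derivative g' y) (at y)"
    and "C1_on UNIV g'"
    using assms(1) unfolding C2_on_def by blast
  then obtain g2 :: "real^'m \<Rightarrow> (real^'m) \<Rightarrow>\<^sub>L ((real^'m) \<Rightarrow>\<^sub>L (real^'l))"
    where g2: "\<And>y. (g' has_derivative g2 y) (at y)"
    unfolding C1_on_def by blast
  have g'_cont: "continuous_on UNIV g'"
    using has_derivative_continuous[OF g2] by (simp add: continuous_at_imp_continuous_on)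
  obtain W f' where W: "open W" "(xbar, ybar) \<in> W"
    and f: "\<And>p. p \<in> W \<Longrightarrow> ((\<lambda>(x, y). f x y) has_derivative blinfun_apply (f' p)) (at p)"
    and f'_cont: "continuous_on W f'"
    using assms(6) unfolding C1_on_def by blast
  note jac_g = jacobian_apply[OF g] transpose_jacobian_apply[OF g]
  have nd: "{g' ybar u + w | u w. w \<in> lin (tangent_cone \<Theta> (g ybar))} = UNIV"
    using assms(8) by (simp add: nondegenerate_def jac_g)
  have mult: "lam \<in> ?L \<longleftrightarrow> lam \<in> normal_cone \<Theta> (g ybar) \<and> f xbar ybar + adjoint (g' ybar) lam = 0"
    for lam
    by (simp add: lagrange_multipliers_def lagrangian_def jac_g del: transpose_matrix_vector)
  have sys: "multiplier_system f f' W g g' (g2 ybar) \<Theta> xbar ybar lam" if "lam \<in> ?L" for lam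
    using that unfolding mult
    by (intro multiplier_system.intro W f f'_cont g g'_cont g2 assms(2,3,10) nd) auto

  have "\<exists>lam. lam \<in> ?L"
  proof -
    obtain v where v: "v \<in> regular_normal_cone (g -` \<Theta>) ybar" "f xbar ybar + v = 0"
      using assms(5) by (auto simp: solution_map_def)
    have "w = 0" if "w \<in> normal_cone \<Theta> (g ybar)" "adjoint (g' ybar) w = 0" for w
      using nondegenerate_adjoint_inj[OF nd] normal_cone_orthogonal_lin[OF assms(3) that(1)] that(2)
      by blast
    then obtain lam where "lam \<in> normal_cone \<Theta> (g ybar)" "v = adjoint (g' ybar) lam"
      using regular_normal_cone_vimage_multiplier[OF g assms(2,3) has_derivative_continuous[OF g2] _ v(1)]
      by blast
    then show ?thesis using v(2) unfolding mult by blast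
  qed
  moreover have "lam1 = lam2" if "lam1 \<in> ?L" "lam2 \<in> ?L" for lam1 lam2
    using multiplier_system.multiplier_unique[OF sys[OF that(2)]] that(1) unfolding mult by blast
  ultimately have unique: "\<exists>!lam. lam \<in> ?L" by blast

  have equiv: "(adjoint_solutions f g \<Theta> xbar ybar lam = {0} \<longrightarrow> isolated_calmness ?S xbar ybar) \<and>
      (surj (\<lambda>h. jacobian (\<lambda>x. f x ybar) (at xbar) *v h) \<longrightarrow> isolated_calmness ?S xbar ybar \<longrightarrow>
        adjoint_solutions f g \<Theta> xbar ybar lam = {0})"
    if lam: "lam \<in> ?L" for lam
  proof -
    interpret multiplier_system f f' W g g' "g2 ybar" \<Theta> xbar ybar lam by (rule sys[OF lam])
    let ?K = "critical_cone \<Theta> (g ybar) lam"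
    have "((\<lambda>u. (xbar, u, lam)) has_derivative (\<lambda>v. (0, v, 0))) (at ybar)"
      by (auto intro!: derivative_eq_intros)
    from diff_chain_at[OF this has_derivative_\<Phi>]
    have "((\<lambda>u. lagrangian f g xbar u lam) has_derivative (\<lambda>v. \<Phi>' (0, v, 0))) (at ybar)"
      by (simp add: comp_def \<Phi>_def lagrangian_def jac_g del: transpose_matrix_vector)
    from jacobian_apply[OF this]
    have "jacobian (\<lambda>u. lagrangian f g xbar u lam) (at ybar) *v v +
        transpose (jacobian g (at ybar)) *v w = \<Phi>' (0, v, w)" for v w
      by (simp add: jac_g \<Phi>'_def bounded_bilinear.zero_right[OF bounded_bilinear_adjoint]
          del: transpose_matrix_vector)
    then have adj: "v \<in> adjoint_solutions f g \<Theta> xbar ybar lam \<longleftrightarrow>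
        (\<exists>w \<in> normal_cone ?K (g' ybar v). \<Phi>' (0, v, w) = 0)" for v
      by (auto simp: adjoint_solutions_def jac_g(1) image_iff simp del: transpose_matrix_vector)
    have "0 \<in> adjoint_solutions f g \<Theta> xbar ybar lam"
      unfolding adj
    proof
      show "0 \<in> normal_cone ?K (g' ybar 0)"
        using zero_in_critical_cone[OF assms(3) lbar(1)] by (simp add: normal_cone_iff)
      show "\<Phi>' (0, 0, 0) = 0"
        using linear_0[OF has_derivative_linear[OF has_derivative_\<Phi>]] by (simp add: zero_prod_def)
    qed
    then have trivial: "adjoint_solutions f g \<Theta> xbar ybar lam = {0} \<longleftrightarrow>
        (\<forall>v. \<forall>w \<in> normal_cone ?K (g' ybar v). \<Phi>' (0, v, w) = 0 \<longrightarrow> v = 0)"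
      using adj by blast
    have "isolated_calmness ?S xbar ybar" if "adjoint_solutions f g \<Theta> xbar ybar lam = {0}"
      using isolated_calmness_sufficient that unfolding trivial by blast
    moreover have "adjoint_solutions f g \<Theta> xbar ybar lam = {0}"
      if surj: "surj (\<lambda>h. jacobian (\<lambda>x. f x ybar) (at xbar) *v h)"
        and calm: "isolated_calmness ?S xbar ybar"
    proof -
      have "((\<lambda>x. (x, ybar)) has_derivative (\<lambda>a. (a, 0))) (at xbar)"
        by (auto intro!: derivative_eq_intros)
      from diff_chain_at[OF this, of "\<lambda>(x, y). f x y" "f' (xbar, ybar)"] f[OF W(2)]
      have "((\<lambda>x. f x ybar) has_derivative (\<lambda>a. f' (xbar, ybar) (a, 0))) (at xbar)"
        by (simp add: comp_def)
      with surj have surj': "surj (\<lambda>a. f' (xbar, ybar) (a, 0))" by (simp add: jacobian_apply)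
      have lift: "\<exists>v m. v \<longlonglongrightarrow> v' \<and> m \<longlonglongrightarrow> m' \<and>
          (\<forall>\<^sub>F k in sequentially. lam + t k *\<^sub>R m k \<in> normal_cone \<Theta> (g (ybar + t k *\<^sub>R v k)))"
        if m': "m' \<in> normal_cone ?K (g' ybar v')" and t: "\<And>k::nat. 0 < t k" "t \<longlonglongrightarrow> (0::real)"
        for v' m' t
      proof (cases "g ybar \<in> interior \<Theta>")
        case True
        show ?thesis
          using normal_variation_lift_interior[where D = "blinfun_apply (g' ybar)" and y = ybar,
              OF g_isCont True assms(2,3,10) lbar(1) m' t] by blast
      next
        case False
        then obtain V \<eta> where "convex \<Xi>" and red: "pointed_reduction \<Theta> (g ybar) \<Xi> V \<eta>"
          using assms(7) unfolding pointed_C2_reducible_def by blast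
        then have V: "open V" "g ybar \<in> V" and \<Theta>\<Xi>: "\<And>u. u \<in> V \<Longrightarrow> u \<in> \<Theta> \<longleftrightarrow> \<eta> u \<in> \<Xi>"
          and pointed: "pointed (tangent_cone \<Xi> (\<eta> (g ybar)))"
          and \<eta>surj: "surj (\<lambda>h. jacobian \<eta> (at (g ybar)) *v h)" and "C2_on V \<eta>"
          unfolding pointed_reduction_def by blast+
        obtain \<eta>' :: "real^'l \<Rightarrow> (real^'l) \<Rightarrow>\<^sub>L (real^'q)"
          where \<eta>: "\<And>z. z \<in> V \<Longrightarrow> (\<eta> has_derivative \<eta>' z) (at z)" and "C1_on V \<eta>'"
          using \<open>C2_on V \<eta>\<close> unfolding C2_on_def by blast
        then obtain \<eta>2 :: "real^'l \<Rightarrow> (real^'l) \<Rightarrow>\<^sub>L ((real^'l) \<Rightarrow>\<^sub>L (real^'q))"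
          where \<eta>2: "\<And>z. z \<in> V \<Longrightarrow> (\<eta>' has_derivative \<eta>2 z) (at z)"
          unfolding C1_on_def by blast
        have \<eta>'cont: "continuous_on V \<eta>'"
          using has_derivative_continuous[OF \<eta>2] by (simp add: continuous_at_imp_continuous_on)
        have \<eta>'surj: "surj (blinfun_apply (\<eta>' (g ybar)))"
          using \<eta>surj by (simp add: jacobian_apply[OF \<eta>[OF V(2)]])
        obtain v m where "v \<longlonglongrightarrow> v'" "m \<longlonglongrightarrow> m'"
          "\<forall>\<^sub>F k in sequentially. lam + t k *\<^sub>R m k \<in> normal_cone \<Theta> (g (ybar + t k *\<^sub>R v k))"
          by (rule normal_variation_lift_reduction[OF g g'_cont assms(2,3,10) lbar(1) nd V \<eta> \<eta>'cont
                \<eta>2[OF V(2)] \<Theta>\<Xi> \<open>convex \<Xi>\<close> pointed \<eta>'surj m' t])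
        then show ?thesis by blast
      qed
      show ?thesis
        unfolding trivial using isolated_calmness_necessary[OF surj' lift calm] by blast
    qed
    ultimately show ?thesis by blast
  qed
  show ?thesis using unique equiv by blast
qed

end
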